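(* Let $A$ and $B$ be bounded lattices with $|A|>2$ and $|B|>2$, and let $A\boxplus B$ be their horizontal sum. (1) The following are equivalent: (1a) ${\rm Con}(A\boxplus B)={\rm Con}_{01}(A\boxplus B)\cup\{\nabla_{A\boxplus B}\}$, and this lattice is isomorphic to $({\rm Con}_{01}(A)\times{\rm Con}_{01}(B))\oplus{\cal L}_2$; (1b) $A\boxplus B$ has no two-class congruences; (1c) ${\rm Spec}_{\rm Filt}(A\boxplus B)=\emptyset$; (1d) ${\rm Spec}_{\rm Id}(A\boxplus B)=\emptyset$; (1e) [$0$ is meet-reducible in $A$ or $1$ is join-reducible in $B$] and [$0$ is meet-reducible in $B$ or $1$ is join-reducible in $A$]. (2) The following are equivalent: (2a) ${\rm Con}(A\boxplus B)={\rm Con}_{01}(A\boxplus B)\cup\{eq(A\setminus\{0\},B\setminus\{1\}),\nabla_{A\boxplus B}\}$, and this lattice is isomorphic to $({\rm Con}_{01}(A)\times{\rm Con}_{01}(B))\oplus{\cal L}_3$; (2b) $eq(A\setminus\{0\},B\setminus\{1\})$ is the unique two-class congruence of $A\boxplus B$; (2c) ${\rm Spec}_{\rm Filt}(A\boxplus B)=\{A\setminus\{0\}\}$; (2d) ${\rm Spec}_{\rm Id}(A\boxplus B)=\{B\setminus\{1\}\}$; (2e) $0$ is meet-irreducible in $A$ and $1$ is join-irreducible in $B$, but [$0$ is meet-reducible in $B$ or $1$ is join-reducible in $A$]. Dually, the following are equivalent: (2a') ${\rm Con}(A\boxplus B)={\rm Con}_{01}(A\boxplus B)\cup\{eq(A\setminus\{1\},B\setminus\{0\}),\nabla_{A\boxplus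 B}\}$, and this lattice is isomorphic to $({\rm Con}_{01}(A)\times{\rm Con}_{01}(B))\oplus{\cal L}_3$; (2b') $eq(A\setminus\{1\},B\setminus\{0\})$ is the unique two-class congruence of $A\boxplus B$; (2c') ${\rm Spec}_{\rm Filt}(A\boxplus B)=\{B\setminus\{0\}\}$; (2d') ${\rm Spec}_{\rm Id}(A\boxplus B)=\{A\setminus\{1\}\}$; (2e') $0$ is meet-irreducible in $B$ and $1$ is join-irreducible in $A$, but [$0$ is meet-reducible in $A$ or $1$ is join-reducible in $B$]. (3) The following are equivalent: (3a) ${\rm Con}(A\boxplus B)={\rm Con}_{01}(A\boxplus B)\cup\{eq(A\setminus\{0\},B\setminus\{1\}),eq(A\setminus\{1\},B\setminus\{0\}),\nabla_{A\boxplus B}\}$, and this lattice is isomorphic to $({\rm Con}_{01}(A)\times{\rm Con}_{01}(B))\oplus{\cal L}_2^2$; (3b) $A\boxplus B$ has two two-class congruences; (3c) ${\rm Spec}_{\rm Filt}(A\boxplus B)=\{A\setminus\{0\},B\setminus\{0\}\}$; (3d) ${\rm Spec}_{\rm Id}(A\boxplus B)=\{A\setminus\{1\},B\setminus\{1\}\}$; (3e) $0$ is meet-irreducible in $A$ and in $B$, and $1$ is join-irreducible in $A$ and in $B$.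
   Context: Horizontal sum: for non-trivial bounded lattices $A$ and $B$ (at least two elements each), $A\boxplus B$ is the bounded lattice obtained from the disjoint union of $A$ and $B$ by identifying $0^A=0^B=:0$ and $1^A=1^B=:1$; $A$ and $B$ are regarded as subsets of $A\boxplus B$ with $A\cap B=\{0,1\}$, and the order is the union of the orders of $A$ and $B$ (so $a\vee b=1$ and $a\wedge b=0$ for $a\in A\setminus\{0,1\}$, $b\in B\setminus\{0,1\}$). For a bounded lattice $L$: ${\rm Con}(L)$ is the lattice of congruences of $L$ (ordered by inclusion), with least element $\Delta_L$ (equality) and greatest element $\nabla_L=L^2$; ${\rm Con}_{01}(L)=\{\theta\in{\rm Con}(L)\mid 0/\theta=\{0\},\,1/\theta=\{1\}\}$, where $x/\theta$ is the $\theta$-class of $x$; this is a principal ideal of ${\rm Con}(L)$, hence a bounded lattice. ${\rm Spec}_{\rm Filt}(L)$ and ${\rm Spec}_{\rm Id}(L)$ are the sets of (proper) prime filters and (proper) prime ideals of $L$. A two-class congruence is a congruence with exactly two classes. For a partition $\{M_1,\dots,M_n\}$ of a set $M$, $eq(M_1,\dots,M_n)$ is the equivalence relation on $M$ whose classes are $M_1,\dots,M_n$. In a bounded lattice, $0$ is meet-irreducible if $x\wedge y=0$ implies $x=0$ or $y=0$, and meet-reducible otherwise; $1$ is join-irreducible if $x\vee y=1$ implies $x=1$ or $y=1$, and join-reducible otherwise. ${\cal L}_n$ is the $n$-element chain, and ${\cal L}_2^2$ is the four-element Boolean lattice. The ordinal sum $K\oplus M$ of a lattice $K$ with top element and a lattice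 $M$ with bottom element is obtained by placing $M$ above $K$ and identifying the top of $K$ with the bottom of $M$. *)

theory Defs
  imports "HOL-Algebra.Lattice"
begin

section \<open>Horizontal sums\<close>

text \<open>
  The glued disjoint union of \<open>A\<close> and \<open>B\<close> is represented inside \<^typ>\<open>'a + 'b\<close>: a point of \<open>A\<close> is
  tagged with \<^const>\<open>Inl\<close>; a point of \<open>B\<close> other than \<open>0\<close>, \<open>1\<close> is tagged with \<^const>\<open>Inr\<close>, while
  \<open>0\<close> and \<open>1\<close> of \<open>B\<close> become the (tagged) \<open>0\<close> and \<open>1\<close> of \<open>A\<close>. The order of \<open>A\<close> and \<open>B\<close> is transported
  along these two embeddings.
\<close>

definition hsum_inA :: "'a gorder \<Rightarrow> 'b gorder \<Rightarrow> 'a \<Rightarrow> 'a + 'b" where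
  "hsum_inA A B a = Inl a"

definition hsum_inB :: "'a gorder \<Rightarrow> 'b gorder \<Rightarrow> 'b \<Rightarrow> 'a + 'b" where
  "hsum_inB A B b =
    (if b = \<bottom>\<^bsub>B\<^esub> then Inl \<bottom>\<^bsub>A\<^esub> else if b = \<top>\<^bsub>B\<^esub> then Inl \<top>\<^bsub>A\<^esub> else Inr b)"

text \<open>\<open>A\<close> and \<open>B\<close> regarded as subsets of their horizontal sum.\<close>

definition hsum_A :: "'a gorder \<Rightarrow> 'b gorder \<Rightarrow> ('a + 'b) set" where
  "hsum_A A B = hsum_inA A B ` carrier A"

definition hsum_B :: "'a gorder \<Rightarrow> 'b gorder \<Rightarrow> ('a + 'b) set" where
  "hsum_B A B = hsum_inB A B ` carrier B"

definition hsum :: "'a gorder \<Rightarrow> 'b gorder \<Rightarrow> ('a + 'b) gorder" (infixl \<open>\<boxplus>\<close> 65) where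
  "A \<boxplus> B =
    \<lparr> carrier = hsum_A A B \<union> hsum_B A B,
      eq = (=),
      le = (\<lambda>x y.
        (\<exists>a\<in>carrier A. \<exists>a'\<in>carrier A. x = hsum_inA A B a \<and> y = hsum_inA A B a' \<and> a \<sqsubseteq>\<^bsub>A\<^esub> a') \<or>
        (\<exists>b\<in>carrier B. \<exists>b'\<in>carrier B. x = hsum_inB A B b \<and> y = hsum_inB A B b' \<and> b \<sqsubseteq>\<^bsub>B\<^esub> b')) \<rparr>"


section \<open>Congruences\<close>

definition congruences :: "'a gorder \<Rightarrow> 'a rel set" where
  "congruences L = {\<theta>. equiv (carrier L) \<theta> \<and>
     (\<forall>(x, x')\<in>\<theta>. \<forall>(y, y')\<in>\<theta>.
        (x \<squnion>\<^bsub>L\<^esub> y, x' \<squnion>\<^bsub>L\<^esub> y') \<in> \<theta> \<and> (x \<sqinter>\<^bsub>L\<^esub> y, x' \<sqinter>\<^bsub>L\<^esub> y') \<in> \<theta>)}"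

definition congruences01 :: "'a gorder \<Rightarrow> 'a rel set" where
  "congruences01 L =
    {\<theta> \<in> congruences L. \<theta> `` {\<bottom>\<^bsub>L\<^esub>} = {\<bottom>\<^bsub>L\<^esub>} \<and> \<theta> `` {\<top>\<^bsub>L\<^esub>} = {\<top>\<^bsub>L\<^esub>}}"

definition Con :: "'a gorder \<Rightarrow> ('a rel) gorder" where
  "Con L = \<lparr> carrier = congruences L, eq = (=), le = (\<subseteq>) \<rparr>"

definition Con01 :: "'a gorder \<Rightarrow> ('a rel) gorder" where
  "Con01 L = \<lparr> carrier = congruences01 L, eq = (=), le = (\<subseteq>) \<rparr>"

definition nabla :: "'a gorder \<Rightarrow> 'a rel" where
  "nabla L = carrier L \<times> carrier L"

definition two_class_congruences :: "'a gorder \<Rightarrow> 'a rel set" where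
  "two_class_congruences L = {\<theta> \<in> congruences L. card (carrier L // \<theta>) = 2}"

text \<open>The equivalence whose classes are the blocks of the partition \<open>P\<close>.\<close>

definition eq_of :: "'a set set \<Rightarrow> 'a rel" where
  "eq_of P = {(x, y). \<exists>M\<in>P. x \<in> M \<and> y \<in> M}"


section \<open>Prime filters and prime ideals\<close>

definition lattice_filter :: "'a gorder \<Rightarrow> 'a set \<Rightarrow> bool" where
  "lattice_filter L F \<longleftrightarrow> F \<subseteq> carrier L \<and> F \<noteq> {} \<and>
     (\<forall>x\<in>F. \<forall>y\<in>F. x \<sqinter>\<^bsub>L\<^esub> y \<in> F) \<and>
     (\<forall>x\<in>F. \<forall>y\<in>carrier L. x \<sqsubseteq>\<^bsub>L\<^esub> y \<longrightarrow> y \<in> F)"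

definition lattice_ideal :: "'a gorder \<Rightarrow> 'a set \<Rightarrow> bool" where
  "lattice_ideal L I \<longleftrightarrow> I \<subseteq> carrier L \<and> I \<noteq> {} \<and>
     (\<forall>x\<in>I. \<forall>y\<in>I. x \<squnion>\<^bsub>L\<^esub> y \<in> I) \<and>
     (\<forall>x\<in>I. \<forall>y\<in>carrier L. y \<sqsubseteq>\<^bsub>L\<^esub> x \<longrightarrow> y \<in> I)"

definition SpecFilt :: "'a gorder \<Rightarrow> 'a set set" where
  "SpecFilt L = {F. lattice_filter L F \<and> F \<noteq> carrier L \<and>
     (\<forall>x\<in>carrier L. \<forall>y\<in>carrier L. x \<squnion>\<^bsub>L\<^esub> y \<in> F \<longrightarrow> x \<in> F \<or> y \<in> F)}"

definition SpecId :: "'a gorder \<Rightarrow> 'a set set" where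
  "SpecId L = {I. lattice_ideal L I \<and> I \<noteq> carrier L \<and>
     (\<forall>x\<in>carrier L. \<forall>y\<in>carrier L. x \<sqinter>\<^bsub>L\<^esub> y \<in> I \<longrightarrow> x \<in> I \<or> y \<in> I)}"


section \<open>Irreducibility of the bounds\<close>

definition bot_meet_irreducible :: "'a gorder \<Rightarrow> bool" where
  "bot_meet_irreducible L \<longleftrightarrow>
    (\<forall>x\<in>carrier L. \<forall>y\<in>carrier L. x \<sqinter>\<^bsub>L\<^esub> y = \<bottom>\<^bsub>L\<^esub> \<longrightarrow> x = \<bottom>\<^bsub>L\<^esub> \<or> y = \<bottom>\<^bsub>L\<^esub>)"

definition top_join_irreducible :: "'a gorder \<Rightarrow> bool" where
  "top_join_irreducible L \<longleftrightarrow>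
    (\<forall>x\<in>carrier L. \<forall>y\<in>carrier L. x \<squnion>\<^bsub>L\<^esub> y = \<top>\<^bsub>L\<^esub> \<longrightarrow> x = \<top>\<^bsub>L\<^esub> \<or> y = \<top>\<^bsub>L\<^esub>)"

abbreviation bot_meet_reducible :: "'a gorder \<Rightarrow> bool" where
  "bot_meet_reducible L \<equiv> \<not> bot_meet_irreducible L"

abbreviation top_join_reducible :: "'a gorder \<Rightarrow> bool" where
  "top_join_reducible L \<equiv> \<not> top_join_irreducible L"


section \<open>Constructions on lattices, isomorphism\<close>

definition chain_lattice :: "nat \<Rightarrow> nat gorder" where
  "chain_lattice n = \<lparr> carrier = {..<n}, eq = (=), le = (\<le>) \<rparr>"

definition prod_lattice :: "'a gorder \<Rightarrow> 'b gorder \<Rightarrow> ('a \<times> 'b) gorder" where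
  "prod_lattice K M =
    \<lparr> carrier = carrier K \<times> carrier M,
      eq = (=),
      le = (\<lambda>(x, y) (x', y'). x \<sqsubseteq>\<^bsub>K\<^esub> x' \<and> y \<sqsubseteq>\<^bsub>M\<^esub> y') \<rparr>"

text \<open>
  Ordinal sum of \<open>K\<close> (with top) and \<open>M\<close> (with bottom): the bottom of \<open>M\<close> is dropped from the upper
  summand, its role being taken over by the top of \<open>K\<close>.
\<close>

definition ordinal_sum :: "'a gorder \<Rightarrow> 'b gorder \<Rightarrow> ('a + 'b) gorder" where
  "ordinal_sum K M =
    \<lparr> carrier = Inl ` carrier K \<union> Inr ` (carrier M - {\<bottom>\<^bsub>M\<^esub>}),
      eq = (=),
      le = (\<lambda>u v. case u of
               Inl x \<Rightarrow> (case v of Inl x' \<Rightarrow> x \<sqsubseteq>\<^bsub>K\<^esub> x' | Inr y' \<Rightarrow> True)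
             | Inr y \<Rightarrow> (case v of Inl x' \<Rightarrow> False | Inr y' \<Rightarrow> y \<sqsubseteq>\<^bsub>M\<^esub> y')) \<rparr>"

text \<open>\<^const>\<open>join_pres\<close> and \<^const>\<open>meet_pres\<close> include that both structures are lattices.\<close>

definition lattice_iso :: "'a gorder \<Rightarrow> 'b gorder \<Rightarrow> bool" (infix \<open>\<cong>\<^sub>l\<close> 50) where
  "K \<cong>\<^sub>l M \<longleftrightarrow> (\<exists>f. bij_betw f (carrier K) (carrier M) \<and> join_pres K M f \<and> meet_pres K M f)"


section \<open>Lists of equivalent statements\<close>

definition all_equivalent :: "bool list \<Rightarrow> bool" where
  "all_equivalent Ps \<longleftrightarrow> (\<forall>P\<in>set Ps. \<forall>Q\<in>set Ps. P \<longleftrightarrow> Q)"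

end

theory Submission
  imports Defs "HOL-Algebra.Complete_Lattice"
begin

text \<open>
  Write \<open>S\<close> for the horizontal sum. Everything is governed by the set of prime filters of \<open>S\<close>, of
  which there are at most two.

  In any bounded lattice, a congruence with exactly two classes is the same thing as a prime filter
  (the class of \<open>1\<close>), and complements turn prime filters into prime ideals; see
  \<open>two_class_congruences_eq\<close> and \<open>SpecId_eq\<close>. In \<open>S\<close>, a proper element of \<open>A\<close> and a proper element
  of \<open>B\<close> are complements of each other, so a prime filter contains exactly one of them. This leaves
  only \<open>A \<setminus> {0}\<close> and \<open>B \<setminus> {0}\<close> as candidates (\<open>SpecFilt_cases\<close>). The set \<open>A \<setminus> {0}\<close> is closed under
  meets iff \<open>0\<close> is meet-irreducible in \<open>A\<close>, and its complement \<open>B \<setminus> {1}\<close> is closed under joins iff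
  \<open>1\<close> is join-irreducible in \<open>B\<close> (\<open>SpecFilt_i_iff\<close>).

  The same complements make congruences rigid: if a congruence of \<open>S\<close> identifies \<open>0\<close> or \<open>1\<close> with
  another element, then these identifications spread to all of \<open>S\<close>, and the congruence is \<open>\<nabla>\<close> or has
  two classes (\<open>big_congruences\<close>). The remaining congruences, with trivial classes of \<open>0\<close> and \<open>1\<close>,
  never relate proper elements of different summands. So such a congruence is glued from one of
  \<open>A\<close> and one of \<open>B\<close>, chosen independently (\<open>glued_bij\<close>), and it lies below all others. Therefore
  the congruence lattice is an ordinal sum of \<open>Con\<^sub>0\<^sub>1(A) \<times> Con\<^sub>0\<^sub>1(B)\<close> and a small upper part,
  which consists of \<open>\<nabla>\<close> and one further, pairwise incomparable, element per prime filter
  (\<open>Con_iso_ordinal_sum\<close>).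

  The four groups of equivalent conditions are then the four possible values of the set of prime
  filters.
\<close>

section \<open>Lattices as ordered sets\<close>

lemma lattice_of_bounds:
  assumes "partial_order L"
    and "\<And>x y. x \<in> carrier L \<Longrightarrow> y \<in> carrier L \<Longrightarrow>
      \<exists>s\<in>carrier L. x \<sqsubseteq>\<^bsub>L\<^esub> s \<and> y \<sqsubseteq>\<^bsub>L\<^esub> s \<and>
        (\<forall>u\<in>carrier L. x \<sqsubseteq>\<^bsub>L\<^esub> u \<longrightarrow> y \<sqsubseteq>\<^bsub>L\<^esub> u \<longrightarrow> s \<sqsubseteq>\<^bsub>L\<^esub> u)"
    and "\<And>x y. x \<in> carrier L \<Longrightarrow> y \<in> carrier L \<Longrightarrow>
      \<exists>s\<in>carrier L. s \<sqsubseteq>\<^bsub>L\<^esub> x \<and> s \<sqsubseteq>\<^bsub>L\<^esub> y \<and>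
        (\<forall>u\<in>carrier L. u \<sqsubseteq>\<^bsub>L\<^esub> x \<longrightarrow> u \<sqsubseteq>\<^bsub>L\<^esub> y \<longrightarrow> u \<sqsubseteq>\<^bsub>L\<^esub> s)"
  shows "lattice L"
proof -
  interpret partial_order L by fact
  show ?thesis
  proof
    fix x y assume xy: "x \<in> carrier L" "y \<in> carrier L"
    show "\<exists>s. least L s (Upper L {x, y})"
      using assms(2)[OF xy] xy by (auto simp: least_def Upper_def)
    show "\<exists>s. greatest L s (Lower L {x, y})"
      using assms(3)[OF xy] xy by (auto simp: greatest_def Lower_def)
  qed
qed

lemma (in lattice) join_eqI:
  assumes "x \<in> carrier L" "y \<in> carrier L" "s \<in> carrier L" "x \<sqsubseteq> s" "y \<sqsubseteq> s"
    and "\<And>u. u \<in> carrier L \<Longrightarrow> x \<sqsubseteq> u \<Longrightarrow> y \<sqsubseteq> u \<Longrightarrow> s \<sqsubseteq> u"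
  shows "x \<squnion> y = s"
  using assms by (intro le_antisym join_le) (auto simp: join_left join_right)

lemma (in lattice) meet_eqI:
  assumes "x \<in> carrier L" "y \<in> carrier L" "s \<in> carrier L" "s \<sqsubseteq> x" "s \<sqsubseteq> y"
    and "\<And>u. u \<in> carrier L \<Longrightarrow> u \<sqsubseteq> x \<Longrightarrow> u \<sqsubseteq> y \<Longrightarrow> u \<sqsubseteq> s"
  shows "x \<sqinter> y = s"
  using assms by (intro le_antisym meet_le) (auto simp: meet_left meet_right)

lemma (in bounded_lattice) bound_ops [simp]:
  assumes "x \<in> carrier L"
  shows "\<bottom> \<sqinter> x = \<bottom>" "x \<sqinter> \<bottom> = \<bottom>" "\<bottom> \<squnion> x = x" "x \<squnion> \<bottom> = x"
    "\<top> \<sqinter> x = x" "x \<sqinter> \<top> = x" "\<top> \<squnion> x = \<top>" "x \<squnion> \<top> = \<top>"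
  using bottom_meet[OF assms] bottom_join[OF assms] top_meet[OF assms] top_join[OF assms]
  by (auto simp: eq_is_equal join_comm[of L x] meet_comm[of L x])

lemma (in bounded_lattice) bot_neq_top:
  assumes "x \<in> carrier L" "x \<noteq> \<bottom>"
  shows "\<bottom> \<noteq> \<top>"
  using bound_ops(2,6)[OF assms(1)] assms(2) by auto

text \<open>
  The order isomorphism goes from \<open>M\<close> to the known lattice \<open>K\<close>. In this way the lattice structure
  of \<open>M\<close> comes for free; for an ordinal sum of products of congruence lattices it would otherwise
  have to be established by computing joins.
\<close>

lemma lattice_iso_of_order_iso:
  assumes "lattice K" and M: "eq M = (=)"
    and f: "bij_betw f (carrier M) (carrier K)"
    and ord: "\<And>x y. x \<in> carrier M \<Longrightarrow> y \<in> carrier M \<Longrightarrow> f x \<sqsubseteq>\<^bsub>K\<^esub> f y \<longleftrightarrow> x \<sqsubseteq>\<^bsub>M\<^esub> y"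
  shows "K \<cong>\<^sub>l M"
proof -
  interpret K: lattice K by fact
  define g where "g = inv_into (carrier M) f"
  have g: "bij_betw g (carrier K) (carrier M)"
    unfolding g_def using f by (rule bij_betw_inv_into)
  have gM[simp]: "g u \<in> carrier M" if "u \<in> carrier K" for u
    using g that by (rule bij_betw_apply)
  have fK[simp]: "f x \<in> carrier K" if "x \<in> carrier M" for x
    using f that by (rule bij_betw_apply)
  have fg[simp]: "f (g u) = u" if "u \<in> carrier K" for u
    unfolding g_def using f that by (rule bij_betw_inv_into_right)
  have gf[simp]: "g (f x) = x" if "x \<in> carrier M" for x
    unfolding g_def using f that by (rule bij_betw_inv_into_left)
  have g_le: "g u \<sqsubseteq>\<^bsub>M\<^esub> x \<longleftrightarrow> u \<sqsubseteq>\<^bsub>K\<^esub> f x" "x \<sqsubseteq>\<^bsub>M\<^esub> g u \<longleftrightarrow> f x \<sqsubseteq>\<^bsub>K\<^esub> u"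
    if "u \<in> carrier K" "x \<in> carrier M" for u x
    using ord[of "g u" x] ord[of x "g u"] that by auto
  interpret M: partial_order M
  proof
    fix x y z assume x: "x \<in> carrier M" "y \<in> carrier M" 
    { assume "x \<sqsubseteq>\<^bsub>M\<^esub> y" "y \<sqsubseteq>\<^bsub>M\<^esub> x"
      then have "f x = f y" using x by (simp add: ord[symmetric] K.le_antisym)
      then show "x .=\<^bsub>M\<^esub> y" using x M gf by metis }
    { assume z: "z \<in> carrier M" "x \<sqsubseteq>\<^bsub>M\<^esub> y" "y \<sqsubseteq>\<^bsub>M\<^esub> z"
      then show "x \<sqsubseteq>\<^bsub>M\<^esub> z" using x
        using K.le_trans[of "f x" "f y" "f z"] by (simp add: ord[symmetric]) }
  qed (auto simp: M ord[symmetric])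
  have "lattice M"
  proof (rule lattice_of_bounds)
    fix x y assume "x \<in> carrier M" "y \<in> carrier M"
    then show "\<exists>s\<in>carrier M. x \<sqsubseteq>\<^bsub>M\<^esub> s \<and> y \<sqsubseteq>\<^bsub>M\<^esub> s \<and>
        (\<forall>u\<in>carrier M. x \<sqsubseteq>\<^bsub>M\<^esub> u \<longrightarrow> y \<sqsubseteq>\<^bsub>M\<^esub> u \<longrightarrow> s \<sqsubseteq>\<^bsub>M\<^esub> u)"
      by (intro bexI[of _ "g (f x \<squnion>\<^bsub>K\<^esub> f y)"])
        (auto simp: g_le K.join_left K.join_right K.join_le ord)
    show "\<exists>s\<in>carrier M. s \<sqsubseteq>\<^bsub>M\<^esub> x \<and> s \<sqsubseteq>\<^bsub>M\<^esub> y \<and>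
        (\<forall>u\<in>carrier M. u \<sqsubseteq>\<^bsub>M\<^esub> x \<longrightarrow> u \<sqsubseteq>\<^bsub>M\<^esub> y \<longrightarrow> u \<sqsubseteq>\<^bsub>M\<^esub> s)"
      using \<open>x \<in> carrier M\<close> \<open>y \<in> carrier M\<close>
      by (intro bexI[of _ "g (f x \<sqinter>\<^bsub>K\<^esub> f y)"])
        (auto simp: g_le K.meet_left K.meet_right K.meet_le ord)
  qed (rule M.partial_order_axioms)
  then interpret M: lattice M .
  have "g (u \<squnion>\<^bsub>K\<^esub> v) = g u \<squnion>\<^bsub>M\<^esub> g v" "g (u \<sqinter>\<^bsub>K\<^esub> v) = g u \<sqinter>\<^bsub>M\<^esub> g v"
    if "u \<in> carrier K" "v \<in> carrier K" for u v
    using that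
    by (intro M.join_eqI[symmetric] M.meet_eqI[symmetric];
        simp add: g_le K.join_left K.join_right K.join_le K.meet_left K.meet_right K.meet_le)+
  then show ?thesis
    unfolding lattice_iso_def join_pres_def meet_pres_def
    using g K.lattice_axioms M.lattice_axioms by blast
qed

section \<open>Congruences, prime filters and prime ideals\<close>

text \<open>
  Compatibility in one argument is enough: for pairs \<open>(x, x')\<close> and \<open>(y, y')\<close>, pass from \<open>x \<squnion> y\<close> to
  \<open>x' \<squnion> y'\<close> by way of \<open>x' \<squnion> y\<close>.
\<close>

lemma congruencesI:
  assumes L: "lattice L" and "equiv (carrier L) \<theta>"
    and "\<And>x x' y. (x, x') \<in> \<theta> \<Longrightarrow> y \<in> carrier L \<Longrightarrow>
      (x \<squnion>\<^bsub>L\<^esub> y, x' \<squnion>\<^bsub>L\<^esub> y) \<in> \<theta> \<and> (x \<sqinter>\<^bsub>L\<^esub> y, x' \<sqinter>\<^bsub>L\<^esub> y) \<in> \<theta>"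
  shows "\<theta> \<in> congruences L"
proof -
  have sub: "\<theta> \<subseteq> carrier L \<times> carrier L" and tr: "trans \<theta>"
    using assms(2) by (auto elim: equivE)
  have "(x \<squnion>\<^bsub>L\<^esub> y, x' \<squnion>\<^bsub>L\<^esub> y') \<in> \<theta> \<and> (x \<sqinter>\<^bsub>L\<^esub> y, x' \<sqinter>\<^bsub>L\<^esub> y') \<in> \<theta>"
    if "(x, x') \<in> \<theta>" "(y, y') \<in> \<theta>" for x x' y y'
    using assms(3)[OF that(1), of y] assms(3)[OF that(2), of x'] sub that tr
    by (auto simp: join_comm[of L x'] meet_comm[of L x'] elim: transE)
  then show ?thesis
    using assms(2) by (auto simp: congruences_def)
qed

lemma congruences_equiv: "\<theta> \<in> congruences L \<Longrightarrow> equiv (carrier L) \<theta>"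
  by (simp add: congruences_def)

lemma congruencesD:
  assumes "\<theta> \<in> congruences L"
  shows "(x, x') \<in> \<theta> \<Longrightarrow> x \<in> carrier L" "(x, x') \<in> \<theta> \<Longrightarrow> x' \<in> carrier L"
    "x \<in> carrier L \<Longrightarrow> (x, x) \<in> \<theta>"
    "(x, x') \<in> \<theta> \<Longrightarrow> (x', x) \<in> \<theta>"
    "(x, x') \<in> \<theta> \<Longrightarrow> (x', x'') \<in> \<theta> \<Longrightarrow> (x, x'') \<in> \<theta>"
    "(x, x') \<in> \<theta> \<Longrightarrow> (y, y') \<in> \<theta> \<Longrightarrow> (x \<squnion>\<^bsub>L\<^esub> y, x' \<squnion>\<^bsub>L\<^esub> y') \<in> \<theta>"
    "(x, x') \<in> \<theta> \<Longrightarrow> (y, y') \<in> \<theta> \<Longrightarrow> (x \<sqinter>\<^bsub>L\<^esub> y, x' \<sqinter>\<^bsub>L\<^esub> y') \<in> \<theta>"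
  using assms unfolding congruences_def equiv_def
  by (auto dest: refl_onD symD transD)

lemma nabla_congruence:
  assumes "lattice L"
  shows "nabla L \<in> congruences L"
proof -
  interpret lattice L by fact
  show ?thesis
    by (auto simp: congruences_def nabla_def equiv_def refl_on_def sym_def trans_def)
qed

lemma Inter_congruences:
  assumes "C \<subseteq> congruences L" "C \<noteq> {}"
  shows "\<Inter>C \<in> congruences L"
proof -
  have "equiv (carrier L) (\<Inter>C)"
    using assms unfolding equiv_def
    by (auto intro!: refl_onI symI transI dest: congruencesD[OF subsetD])
  moreover have "(x \<squnion>\<^bsub>L\<^esub> y, x' \<squnion>\<^bsub>L\<^esub> y') \<in> \<Inter>C \<and> (x \<sqinter>\<^bsub>L\<^esub> y, x' \<sqinter>\<^bsub>L\<^esub> y') \<in> \<Inter>C"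
    if "(x, x') \<in> \<Inter>C" "(y, y') \<in> \<Inter>C" for x x' y y'
    using that assms(1) congruencesD(6,7)[of _ L x x' y y'] by blast
  ultimately show ?thesis
    by (auto simp: congruences_def)
qed

text \<open>
  Congruences are closed under intersections and have a greatest element.
\<close>

lemma Con_lattice:
  assumes "lattice L"
  shows "lattice (Con L)"
proof -
  interpret C: partial_order "Con L"
    by standard (auto simp: Con_def)
  have "complete_lattice (Con L)"
  proof (rule C.complete_lattice_criterion1)
    show "\<exists>g. greatest (Con L) g (carrier (Con L))"
      using nabla_congruence[OF assms]
      by (intro exI[of _ "nabla L"])
        (auto simp: greatest_def Con_def nabla_def dest: congruencesD)
    show "\<exists>i. greatest (Con L) i (Lower (Con L) C)" if "C \<subseteq> carrier (Con L)" "C \<noteq> {}" for C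
      using that Inter_congruences[of C L]
      by (intro exI[of _ "\<Inter>C"]) (auto simp: greatest_def Lower_def Con_def)
  qed
  then interpret C: complete_lattice "Con L" .
  show ?thesis by (rule C.lattice_axioms)
qed

text \<open>
  Meeting \<open>\<bottom> \<equiv> \<top>\<close> with any \<open>x\<close> gives \<open>\<bottom> \<equiv> x\<close>.
\<close>

lemma congruence_bot_top:
  fixes L :: "'a gorder" (structure)
  assumes "bounded_lattice L"
    and \<theta>: "\<theta> \<in> congruences L" and bt: "(\<bottom>, \<top>) \<in> \<theta>"
  shows "\<theta> = nabla L"
proof -
  interpret bounded_lattice L by fact
  have "(\<bottom>, x) \<in> \<theta>" if "x \<in> carrier L" for x
    using congruencesD(7)[OF \<theta> bt congruencesD(3)[OF \<theta> that]] that
    by simp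
  then have "(x, y) \<in> \<theta>" if "x \<in> carrier L" "y \<in> carrier L" for x y
    using congruencesD(5)[OF \<theta> congruencesD(4)[OF \<theta>]] that \<open>\<And>x. x \<in> carrier L \<Longrightarrow> (\<bottom>, x) \<in> \<theta>\<close>
    by metis
  then show ?thesis
    using congruences_equiv[OF \<theta>] by (auto simp: nabla_def equiv_def)
qed

lemma SpecFiltI:
  assumes "F \<subseteq> carrier L" "b \<in> carrier L" "b \<notin> F" "t \<in> F"
    and "\<And>x y. x \<in> F \<Longrightarrow> y \<in> F \<Longrightarrow> x \<sqinter>\<^bsub>L\<^esub> y \<in> F"
    and "\<And>x y. x \<in> F \<Longrightarrow> y \<in> carrier L \<Longrightarrow> x \<sqsubseteq>\<^bsub>L\<^esub> y \<Longrightarrow> y \<in> F"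
    and "\<And>x y. x \<in> carrier L \<Longrightarrow> y \<in> carrier L \<Longrightarrow> x \<squnion>\<^bsub>L\<^esub> y \<in> F \<Longrightarrow> x \<in> F \<or> y \<in> F"
  shows "F \<in> SpecFilt L"
  using assms unfolding SpecFilt_def lattice_filter_def by blast

lemma SpecFiltD:
  assumes "F \<in> SpecFilt L"
  shows "F \<subseteq> carrier L"
    "x \<in> F \<Longrightarrow> y \<in> F \<Longrightarrow> x \<sqinter>\<^bsub>L\<^esub> y \<in> F"
    "x \<in> F \<Longrightarrow> y \<in> carrier L \<Longrightarrow> x \<sqsubseteq>\<^bsub>L\<^esub> y \<Longrightarrow> y \<in> F"
    "x \<in> carrier L \<Longrightarrow> y \<in> carrier L \<Longrightarrow> x \<squnion>\<^bsub>L\<^esub> y \<in> F \<Longrightarrow> x \<in> F \<or> y \<in> F"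
    "F \<noteq> {}" "F \<noteq> carrier L"
  using assms unfolding SpecFilt_def lattice_filter_def by blast+

lemma SpecIdI:
  assumes "F \<subseteq> carrier L" "b \<in> carrier L" "b \<notin> F" "t \<in> F"
    and "\<And>x y. x \<in> F \<Longrightarrow> y \<in> F \<Longrightarrow> x \<squnion>\<^bsub>L\<^esub> y \<in> F"
    and "\<And>x y. x \<in> F \<Longrightarrow> y \<in> carrier L \<Longrightarrow> y \<sqsubseteq>\<^bsub>L\<^esub> x \<Longrightarrow> y \<in> F"
    and "\<And>x y. x \<in> carrier L \<Longrightarrow> y \<in> carrier L \<Longrightarrow> x \<sqinter>\<^bsub>L\<^esub> y \<in> F \<Longrightarrow> x \<in> F \<or> y \<in> F"
  shows "F \<in> SpecId L"
  using assms unfolding SpecId_def lattice_ideal_def by blast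

lemma SpecIdD:
  assumes "F \<in> SpecId L"
  shows "F \<subseteq> carrier L"
    "x \<in> F \<Longrightarrow> y \<in> F \<Longrightarrow> x \<squnion>\<^bsub>L\<^esub> y \<in> F"
    "x \<in> F \<Longrightarrow> y \<in> carrier L \<Longrightarrow> y \<sqsubseteq>\<^bsub>L\<^esub> x \<Longrightarrow> y \<in> F"
    "x \<in> carrier L \<Longrightarrow> y \<in> carrier L \<Longrightarrow> x \<sqinter>\<^bsub>L\<^esub> y \<in> F \<Longrightarrow> x \<in> F \<or> y \<in> F"
    "F \<noteq> {}" "F \<noteq> carrier L"
  using assms unfolding SpecId_def lattice_ideal_def by blast+

text \<open>
  A set and its complement are the blocks of a congruence if and only if the block of \<open>1\<close> is a
  prime filter: closure of the blocks under the operations says that one is a filter and the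
  other an ideal, and primeness of a filter says that its complement is closed under joins.
\<close>

lemma eq_of_congruence_iff:
  fixes L :: "'a gorder" (structure)
  assumes "bounded_lattice L"
    and F: "F \<subseteq> carrier L" and bot: "\<bottom> \<notin> F" and top: "\<top> \<in> F"
  shows "eq_of {F, carrier L - F} \<in> congruences L \<longleftrightarrow> F \<in> SpecFilt L"
    (is "?\<theta> \<in> _ \<longleftrightarrow> _")
proof -
  interpret bounded_lattice L by fact
  show ?thesis
  proof
    assume \<theta>: "?\<theta> \<in> congruences L"
    have meet: "x \<sqinter> y \<in> F" if "x \<in> F" "y \<in> F" for x y
    proof -
      have "(x, \<top>) \<in> ?\<theta>" "(y, \<top>) \<in> ?\<theta>" using that top by (auto simp: eq_of_def)
      then have "(x \<sqinter> y, \<top> \<sqinter> \<top>) \<in> ?\<theta>" by (rule congruencesD(7)[OF \<theta>])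
      then show ?thesis
        using top by (auto simp: eq_of_def)
    qed
    have up: "y \<in> F" if "x \<in> F" "y \<in> carrier L" "x \<sqsubseteq> y" for x y
    proof -
      have "(x, \<top>) \<in> ?\<theta>" using that top by (auto simp: eq_of_def)
      then have "(x \<squnion> y, \<top> \<squnion> y) \<in> ?\<theta>"
        by (rule congruencesD(6)[OF \<theta> _ congruencesD(3)[OF \<theta> that(2)]])
      moreover have "x \<squnion> y = y" using that F by (simp add: le_iff_meet[symmetric] subsetD)
      ultimately show ?thesis
        using top that by (auto simp: eq_of_def)
    qed
    have prime: "x \<in> F \<or> y \<in> F" if "x \<in> carrier L" "y \<in> carrier L" "x \<squnion> y \<in> F" for x y
    proof (rule ccontr)
      assume "\<not> (x \<in> F \<or> y \<in> F)"
      then have "(x, \<bottom>) \<in> ?\<theta>" "(y, \<bottom>) \<in> ?\<theta>" using that bot by (auto simp: eq_of_def)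
      then have "(x \<squnion> y, \<bottom> \<squnion> \<bottom>) \<in> ?\<theta>" by (rule congruencesD(6)[OF \<theta>])
      then show False
        using bot that by (simp add: eq_of_def)
    qed
    show "F \<in> SpecFilt L"
      using F bottom_closed bot top meet up prime by (rule SpecFiltI)
  next
    assume "F \<in> SpecFilt L"
    note meet = SpecFiltD(2)[OF this] and up = SpecFiltD(3)[OF this] and prime = SpecFiltD(4)[OF this]
    have *: "x \<squnion> y \<in> F \<longleftrightarrow> x \<in> F \<or> y \<in> F" "x \<sqinter> y \<in> F \<longleftrightarrow> x \<in> F \<and> y \<in> F"
      if "x \<in> carrier L" "y \<in> carrier L" for x y
      using that prime[OF that] meet[of x y] up[of x "x \<squnion> y"] up[of y "x \<squnion> y"]
        up[of "x \<sqinter> y" x] up[of "x \<sqinter> y" y]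
        join_left[OF that] join_right[OF that] meet_left[OF that] meet_right[OF that]
        join_closed[OF that]
      by blast+
    have mem: "(x, y) \<in> ?\<theta> \<longleftrightarrow> x \<in> carrier L \<and> y \<in> carrier L \<and> (x \<in> F \<longleftrightarrow> y \<in> F)" for x y
      using F by (auto simp: eq_of_def)
    show "?\<theta> \<in> congruences L"
    proof (rule congruencesI)
      show "equiv (carrier L) ?\<theta>"
        by (rule equivI) (auto simp: mem intro!: refl_onI symI transI)
    qed (auto simp: mem * lattice_axioms)
  qed
qed

lemma SpecFilt_bounds:
  fixes L :: "'a gorder" (structure)
  assumes "bounded_lattice L"
    and "F \<in> SpecFilt L"
  shows "F \<subseteq> carrier L" "\<top> \<in> F" "\<bottom> \<notin> F"
proof -
  interpret bounded_lattice L by fact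
  note F = SpecFiltD[OF assms(2)]
  show "F \<subseteq> carrier L" by (rule F(1))
  obtain x where x: "x \<in> F" using F(5) by blast
  have "x \<in> carrier L" using x F(1) by blast
  then show "\<top> \<in> F" using F(3)[OF x top_closed] by simp
  show "\<bottom> \<notin> F"
  proof
    assume "\<bottom> \<in> F"
    then have "y \<in> F" if "y \<in> carrier L" for y
      using F(3) that by simp
    then show False using F(1,6) by blast
  qed
qed

text \<open>
  If \<open>\<bottom>\<close> and \<open>\<top>\<close> were related, there would be one class only. So in a congruence with two classes
  these are the classes of \<open>\<bottom>\<close> and \<open>\<top>\<close>, and the latter is a prime filter.
\<close>

lemma two_class_congruences_eq:
  fixes L :: "'a gorder" (structure)
  assumes "bounded_lattice L"
  shows "two_class_congruences L = (\<lambda>F. eq_of {F, carrier L - F}) ` SpecFilt L"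
proof -
  interpret bounded_lattice L by fact
  show ?thesis
  proof (intro equalityI subsetI)
    fix \<theta> assume "\<theta> \<in> two_class_congruences L"
    then have \<theta>: "\<theta> \<in> congruences L" and card: "card (carrier L // \<theta>) = 2"
      by (auto simp: two_class_congruences_def)
    have equ: "equiv (carrier L) \<theta>" using \<theta> by (rule congruences_equiv)
    define F where "F = \<theta> `` {\<top>}"
    have bt: "(\<bottom>, \<top>) \<notin> \<theta>"
    proof
      assume "(\<bottom>, \<top>) \<in> \<theta>"
      then have "\<theta> = nabla L" using assms \<theta> by (intro congruence_bot_top)
      then have "carrier L // \<theta> \<subseteq> {carrier L}" by (auto simp: quotient_def nabla_def)
      then have "card (carrier L // \<theta>) \<le> 1"
        using card_mono[of "{carrier L}"] by simp
      with card show False by simp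
    qed
    have "{F, \<theta> `` {\<bottom>}} = carrier L // \<theta>"
    proof (rule card_subset_eq)
      show "finite (carrier L // \<theta>)" using card card.infinite by fastforce
      show "{F, \<theta> `` {\<bottom>}} \<subseteq> carrier L // \<theta>" by (auto simp: F_def intro: quotientI)
      have "F \<noteq> \<theta> `` {\<bottom>}"
        using bt congruencesD(3)[OF \<theta>, of \<top>] by (auto simp: F_def)
      then show "card {F, \<theta> `` {\<bottom>}} = card (carrier L // \<theta>)" using card by simp
    qed
    then have cl: "\<theta> `` {x} = F \<or> \<theta> `` {x} = \<theta> `` {\<bottom>}" if "x \<in> carrier L" for x
      using quotientI[OF that, of \<theta>] by auto
    have "\<theta> = eq_of {F, carrier L - F}"
    proof (intro equalityI subrelI)
      fix x y assume "(x, y) \<in> \<theta>"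
      then show "(x, y) \<in> eq_of {F, carrier L - F}"
        by (auto simp: eq_of_def F_def dest: congruencesD(1,2,4,5)[OF \<theta>])
    next
      fix x y assume "(x, y) \<in> eq_of {F, carrier L - F}"
      then consider "x \<in> F" "y \<in> F" | "x \<in> carrier L" "y \<in> carrier L" "x \<notin> F" "y \<notin> F"
        by (auto simp: eq_of_def)
      then show "(x, y) \<in> \<theta>"
      proof cases
        case 1
        then show ?thesis by (auto simp: F_def intro: congruencesD(4,5)[OF \<theta>])
      next
        case 2
        then have "\<theta> `` {x} = \<theta> `` {\<bottom>}" "\<theta> `` {y} = \<theta> `` {\<bottom>}"
          using cl congruencesD(3)[OF \<theta>] by blast+
        then show ?thesis using 2 congruencesD(3)[OF \<theta>] by auto
      qed
    qed
    moreover from this have "F \<in> SpecFilt L"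
      using \<theta> bt congruencesD(3)[OF \<theta> top_closed]
      by (subst eq_of_congruence_iff[OF assms, symmetric])
        (auto simp: F_def dest: congruencesD(2,4)[OF \<theta>])
    ultimately show "\<theta> \<in> (\<lambda>F. eq_of {F, carrier L - F}) ` SpecFilt L" by blast
  next
    fix \<theta> assume "\<theta> \<in> (\<lambda>F. eq_of {F, carrier L - F}) ` SpecFilt L"
    then obtain F where F: "F \<in> SpecFilt L" and \<theta>: "\<theta> = eq_of {F, carrier L - F}" by blast
    note b = SpecFilt_bounds[OF assms F]
    have "\<theta> `` {x} = (if x \<in> F then F else carrier L - F)" if "x \<in> carrier L" for x
      using that b(1) unfolding \<theta> eq_of_def by (intro Set.set_eqI) (simp; blast)
    then have "carrier L // \<theta> = (\<lambda>x. if x \<in> F then F else carrier L - F) ` carrier L"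
      by (auto simp: quotient_def)
    also have "\<dots> = {F, carrier L - F}"
    proof (intro equalityI subsetI)
      fix C assume "C \<in> {F, carrier L - F}"
      then consider "C = F" | "C = carrier L - F" by blast
      then show "C \<in> (\<lambda>x. if x \<in> F then F else carrier L - F) ` carrier L"
      proof cases
        case 1
        show ?thesis by (rule image_eqI[of _ _ \<top>]) (simp_all add: 1 b)
      next
        case 2
        show ?thesis by (rule image_eqI[of _ _ \<bottom>]) (simp_all add: 2 b)
      qed
    qed (simp split: if_splits add: image_iff; blast)
    finally have "carrier L // \<theta> = {F, carrier L - F}" .
    moreover have "F \<noteq> carrier L - F" using b(2) by blast
    ultimately have "card (carrier L // \<theta>) = 2" by simp
    moreover have "\<theta> \<in> congruences L" using F b eq_of_congruence_iff[OF assms] \<theta> by blast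
    ultimately show "\<theta> \<in> two_class_congruences L"
      by (simp add: two_class_congruences_def)
  qed
qed

text \<open>
  Each clause in the definition of a prime filter is the contrapositive of a clause in the
  definition of a prime ideal for the complement: closure under meets becomes primeness, and
  primeness becomes closure under joins.
\<close>

lemma SpecId_eq:
  fixes L :: "'a gorder" (structure)
  assumes "bounded_lattice L"
  shows "SpecId L = (\<lambda>F. carrier L - F) ` SpecFilt L"
proof -
  interpret bounded_lattice L by fact
  have ideal: "carrier L - F \<in> SpecId L" if F: "F \<in> SpecFilt L" for F
  proof (rule SpecIdI)
    note b = SpecFilt_bounds[OF assms F] and f = SpecFiltD[OF F]
    show "carrier L - F \<subseteq> carrier L" "\<top> \<in> carrier L" "\<top> \<notin> carrier L - F"
      "\<bottom> \<in> carrier L - F"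
      using b by simp_all
    show "x \<squnion> y \<in> carrier L - F" if "x \<in> carrier L - F" "y \<in> carrier L - F" for x y
      using that f(4)[of x y] join_closed[of x y] by blast
    show "y \<in> carrier L - F" if "x \<in> carrier L - F" "y \<in> carrier L" "y \<sqsubseteq> x" for x y
      using that f(3)[of y x] by blast
    show "x \<in> carrier L - F \<or> y \<in> carrier L - F"
      if "x \<in> carrier L" "y \<in> carrier L" "x \<sqinter> y \<in> carrier L - F" for x y
      using that f(2)[of x y] by blast
  qed
  have filter: "carrier L - I \<in> SpecFilt L" "I \<subseteq> carrier L" if I: "I \<in> SpecId L" for I
  proof -
    note d = SpecIdD[OF I]
    show "I \<subseteq> carrier L" by (rule d(1))
    obtain x where x: "x \<in> I" using d(5) by blast
    have bot: "\<bottom> \<in> I" using x d(1) d(3)[OF x bottom_closed] by (simp add: subsetD)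
    have top: "\<top> \<notin> I"
    proof
      assume "\<top> \<in> I"
      then have "y \<in> I" if "y \<in> carrier L" for y
        using d(3) that by simp
      then show False using d(1,6) by blast
    qed
    show "carrier L - I \<in> SpecFilt L"
    proof (rule SpecFiltI)
      show "carrier L - I \<subseteq> carrier L" "\<bottom> \<in> carrier L" "\<bottom> \<notin> carrier L - I"
        "\<top> \<in> carrier L - I"
        using bot top by simp_all
      show "x \<sqinter> y \<in> carrier L - I" if "x \<in> carrier L - I" "y \<in> carrier L - I" for x y
        using that d(4)[of x y] meet_closed[of x y] by blast
      show "y \<in> carrier L - I" if "x \<in> carrier L - I" "y \<in> carrier L" "x \<sqsubseteq> y" for x y
        using that d(3)[of y x] by blast
      show "x \<in> carrier L - I \<or> y \<in> carrier L - I"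
        if "x \<in> carrier L" "y \<in> carrier L" "x \<squnion> y \<in> carrier L - I" for x y
        using that d(2)[of x y] by blast
    qed
  qed
  show ?thesis
  proof (intro equalityI subsetI)
    fix I assume I: "I \<in> SpecId L"
    then have "I = carrier L - (carrier L - I)" using filter(2)[OF I] by blast
    then show "I \<in> (\<lambda>F. carrier L - F) ` SpecFilt L" using filter(1)[OF I] by (rule image_eqI)
  qed (use ideal in blast)
qed

section \<open>Congruences and prime filters of a horizontal union\<close>

text \<open>
  The partition into \<open>F\<close> and its complement remembers \<open>F\<close>, as the block of \<open>t\<close>. With \<open>t = \<top>\<close> this
  makes the passage from prime filters to two-class congruences injective.
\<close>

lemma eq_of_block:
  assumes "F \<subseteq> C" "t \<in> F"
  shows "eq_of {F, C - F} `` {t} = F"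
  using assms unfolding eq_of_def by blast

lemma set_diff_of_overlap:
  assumes "C = X \<union> Y" "X \<inter> Y = {b, t}" "b \<noteq> t"
  shows "C - (X - {b}) = Y - {t}"
  using assms by blast

text \<open>
  The shape of a horizontal sum, stated inside one lattice: two subsets that meet in the bounds
  and cover everything, such that proper elements of different subsets are complements.
\<close>

locale horizontal_union = bounded_lattice S for S :: "'c gorder" (structure) +
  fixes X Y :: "'c set"
  assumes carrier_eq: "carrier S = X \<union> Y"
    and inter_eq: "X \<inter> Y = {\<bottom>, \<top>}"
    and mixed_join: "x \<in> X - {\<bottom>, \<top>} \<Longrightarrow> y \<in> Y - {\<bottom>, \<top>} \<Longrightarrow> x \<squnion> y = \<top>"
    and mixed_meet: "x \<in> X - {\<bottom>, \<top>} \<Longrightarrow> y \<in> Y - {\<bottom>, \<top>} \<Longrightarrow> x \<sqinter> y = \<bottom>"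
    and proper_X: "X - {\<bottom>, \<top>} \<noteq> {}"
    and proper_Y: "Y - {\<bottom>, \<top>} \<noteq> {}"
begin

lemma swap: "horizontal_union S Y X"
proof
  show "carrier S = Y \<union> X" "Y \<inter> X = {\<bottom>, \<top>}"
    using carrier_eq inter_eq by (simp_all add: Un_commute Int_commute)
  show "x \<squnion> y = \<top>" "x \<sqinter> y = \<bottom>" if "x \<in> Y - {\<bottom>, \<top>}" "y \<in> X - {\<bottom>, \<top>}" for x y
    using mixed_join[OF that(2,1)] mixed_meet[OF that(2,1)]
    by (simp_all only: join_comm[of S x] meet_comm[of S x])
qed (rule proper_Y proper_X)+

lemma bounds_distinct: "\<bottom> \<noteq> \<top>"
proof -
  obtain x where x: "x \<in> X" "x \<noteq> \<bottom>" using proper_X by blast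
  then have "x \<in> carrier S" using carrier_eq by blast
  then show ?thesis using x(2) by (rule bot_neq_top)
qed

lemma X_sub: "x \<in> X \<Longrightarrow> x \<in> carrier S" and Y_sub: "y \<in> Y \<Longrightarrow> y \<in> carrier S"
  using carrier_eq by simp_all

lemma bounds_X: "\<bottom> \<in> X" "\<top> \<in> X" and bounds_Y: "\<bottom> \<in> Y" "\<top> \<in> Y"
  using inter_eq by blast+

lemma complement_bot: "carrier S - (X - {\<bottom>}) = Y - {\<top>}"
  by (rule set_diff_of_overlap[OF carrier_eq inter_eq bounds_distinct])

lemma complement_top: "carrier S - (X - {\<top>}) = Y - {\<bottom>}"
  using set_diff_of_overlap[OF carrier_eq _ bounds_distinct[symmetric]] inter_eq
  by (simp add: insert_commute)

text \<open>
  A proper element of \<open>X\<close> in a prime filter excludes the proper elements of \<open>Y\<close>, its complements;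
  these in turn, by primeness, force all other proper elements of \<open>X\<close> into the filter.
\<close>

lemma SpecFilt_of_proper:
  assumes F: "F \<in> SpecFilt S" and x: "x \<in> X - {\<bottom>, \<top>}" "x \<in> F"
  shows "F = X - {\<bottom>}"
proof -
  note b = SpecFilt_bounds[OF bounded_lattice_axioms F]
  have no_Y: "y \<notin> F" if "y \<in> Y - {\<bottom>, \<top>}" for y
    using SpecFiltD(2)[OF F x(2), of y] mixed_meet[OF x(1) that] b(3) by auto
  obtain y where y: "y \<in> Y - {\<bottom>, \<top>}" using proper_Y by blast
  have "a \<in> F" if "a \<in> X - {\<bottom>, \<top>}" for a
  proof -
    have "a \<squnion> y \<in> F" using mixed_join[OF that y] b(2) by simp
    then show ?thesis
      using SpecFiltD(4)[OF F X_sub Y_sub] that y no_Y[OF y] by blast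
  qed
  then show ?thesis
    using b no_Y carrier_eq inter_eq by blast
qed

lemma SpecFilt_cases:
  assumes F: "F \<in> SpecFilt S"
  shows "F = X - {\<bottom>} \<or> F = Y - {\<bottom>}"
proof -
  obtain x where x: "x \<in> X - {\<bottom>, \<top>}" using proper_X by blast
  obtain y where y: "y \<in> Y - {\<bottom>, \<top>}" using proper_Y by blast
  have "x \<squnion> y \<in> F"
    using mixed_join[OF x y] SpecFilt_bounds(2)[OF bounded_lattice_axioms F] by simp
  then have "x \<in> F \<or> y \<in> F"
    using SpecFiltD(4)[OF F X_sub Y_sub] x y by blast
  then show ?thesis
    using SpecFilt_of_proper[OF F x] horizontal_union.SpecFilt_of_proper[OF swap F y] by blast
qed

text \<open>
  Joining with a proper \<open>y\<close> of \<open>Y\<close> turns \<open>\<bottom> \<equiv> x\<close> into \<open>y \<equiv> \<top>\<close>, and meeting that with a proper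
  \<open>a\<close> of \<open>X\<close> gives \<open>\<bottom> \<equiv> a\<close>. So a single identification with \<open>\<bottom>\<close> collapses both blocks.
\<close>

lemma congruence_of_bot_pair:
  assumes \<theta>: "\<theta> \<in> congruences S" and bt: "(\<bottom>, \<top>) \<notin> \<theta>"
    and x: "x \<in> X - {\<bottom>, \<top>}" "(\<bottom>, x) \<in> \<theta>"
  shows "\<theta> = eq_of {Y - {\<bottom>}, X - {\<top>}}"
proof -
  note refl = congruencesD(3)[OF \<theta>] and sym = congruencesD(4)[OF \<theta>]
    and trans = congruencesD(5)[OF \<theta>]
  have Y_top: "(y, \<top>) \<in> \<theta>" if y: "y \<in> Y - {\<bottom>}" for y
  proof (cases "y = \<top>")
    case False
    have yS: "y \<in> carrier S" using y Y_sub by blast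
    have "x \<squnion> y = \<top>" using y False by (intro mixed_join[OF x(1)]) simp
    then show ?thesis
      using congruencesD(6)[OF \<theta> x(2) refl[OF yS]] yS by simp
  qed (simp add: refl)
  obtain y where y: "y \<in> Y - {\<bottom>, \<top>}" using proper_Y by blast
  have X_bot: "(\<bottom>, a) \<in> \<theta>" if a: "a \<in> X - {\<top>}" for a
  proof (cases "a = \<bottom>")
    case False
    have aS: "a \<in> carrier S" using a X_sub by blast
    have "a \<sqinter> y = \<bottom>" using a False by (intro mixed_meet[OF _ y]) simp
    moreover have "(y, \<top>) \<in> \<theta>" using Y_top y by blast
    ultimately show ?thesis
      using congruencesD(7)[OF \<theta> refl[OF aS], of y \<top>] aS by simp
  qed (simp add: refl)
  have cover: "u \<in> X - {\<top>} \<or> u \<in> Y - {\<bottom>}" if "u \<in> carrier S" for u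
    using that complement_top by blast
  have no_cross: False if "u \<in> X - {\<top>}" "v \<in> Y - {\<bottom>}" "(u, v) \<in> \<theta>" for u v
    using trans[OF trans[OF X_bot[OF that(1)] that(3)] Y_top[OF that(2)]] bt by simp
  show ?thesis
  proof (intro equalityI subrelI)
    fix u v assume uv: "(u, v) \<in> \<theta>"
    have "u \<in> carrier S" "v \<in> carrier S"
      using congruencesD(1,2)[OF \<theta> uv] by simp_all
    then show "(u, v) \<in> eq_of {Y - {\<bottom>}, X - {\<top>}}"
      using cover[of u] cover[of v] no_cross[OF _ _ uv] no_cross[OF _ _ sym[OF uv]]
      by (simp add: eq_of_def) blast
  next
    fix u v assume "(u, v) \<in> eq_of {Y - {\<bottom>}, X - {\<top>}}"
    then consider "u \<in> X - {\<top>}" "v \<in> X - {\<top>}" | "u \<in> Y - {\<bottom>}" "v \<in> Y - {\<bottom>}"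
      unfolding eq_of_def by blast
    then show "(u, v) \<in> \<theta>"
      by cases (rule trans[OF sym[OF X_bot] X_bot] trans[OF Y_top sym[OF Y_top]], assumption+)+
  qed
qed

text \<open>
  Meeting \<open>\<top> \<equiv> x\<close> with a proper \<open>y\<close> of \<open>Y\<close> gives \<open>y \<equiv> \<bottom>\<close>, an identification with \<open>\<bottom>\<close> in the other
  subset.
\<close>

lemma congruence_of_top_pair:
  assumes \<theta>: "\<theta> \<in> congruences S" and bt: "(\<bottom>, \<top>) \<notin> \<theta>"
    and x: "x \<in> X - {\<bottom>, \<top>}" "(\<top>, x) \<in> \<theta>"
  shows "\<theta> = eq_of {X - {\<bottom>}, Y - {\<top>}}"
proof -
  obtain y where y: "y \<in> Y - {\<bottom>, \<top>}" using proper_Y by blast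
  then have yS: "y \<in> carrier S" using Y_sub by blast
  have "(y, \<bottom>) \<in> \<theta>"
    using congruencesD(7)[OF \<theta> x(2) congruencesD(3)[OF \<theta> yS]] mixed_meet[OF x(1) y] yS by simp
  then show ?thesis
    using horizontal_union.congruence_of_bot_pair[OF swap \<theta> bt y] congruencesD(4)[OF \<theta>] by blast
qed

lemma congruence_cases:
  assumes "\<theta> \<in> congruences S - congruences01 S" "\<theta> \<noteq> nabla S"
  shows "\<theta> = eq_of {X - {\<bottom>}, Y - {\<top>}} \<or> \<theta> = eq_of {Y - {\<bottom>}, X - {\<top>}}"
proof -
  have \<theta>: "\<theta> \<in> congruences S" using assms by blast
  have bt: "(\<bottom>, \<top>) \<notin> \<theta>"
    using congruence_bot_top[OF bounded_lattice_axioms \<theta>] assms(2) by blast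
  have tb: "(\<top>, \<bottom>) \<notin> \<theta>" using bt congruencesD(4)[OF \<theta>] by blast
  have "\<theta> `` {\<bottom>} \<noteq> {\<bottom>} \<or> \<theta> `` {\<top>} \<noteq> {\<top>}"
    using assms(1) by (simp add: congruences01_def)
  then have "(\<exists>u. u \<noteq> \<bottom> \<and> (\<bottom>, u) \<in> \<theta>) \<or> (\<exists>u. u \<noteq> \<top> \<and> (\<top>, u) \<in> \<theta>)"
    using congruencesD(3)[OF \<theta> bottom_closed] congruencesD(3)[OF \<theta> top_closed] by auto
  then obtain u where u: "u \<noteq> \<bottom>" "u \<noteq> \<top>" "(\<bottom>, u) \<in> \<theta> \<or> (\<top>, u) \<in> \<theta>"
    using bt tb by metis
  then have "u \<in> carrier S" using congruencesD(2)[OF \<theta>] by blast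
  then have "u \<in> X - {\<bottom>, \<top>} \<or> u \<in> Y - {\<bottom>, \<top>}" using u carrier_eq by blast
  then show ?thesis
    using u(3) congruence_of_bot_pair[OF \<theta> bt, of u] congruence_of_top_pair[OF \<theta> bt, of u]
      horizontal_union.congruence_of_bot_pair[OF swap \<theta> bt, of u]
      horizontal_union.congruence_of_top_pair[OF swap \<theta> bt, of u]
    by blast
qed

lemma complement_bot_Y: "carrier S - (Y - {\<bottom>}) = X - {\<top>}"
  by (rule horizontal_union.complement_bot[OF swap])

text \<open>
  A congruence that identifies a bound with another element was seen to be \<open>\<nabla>\<close> or to have two
  classes, and these come from prime filters. Conversely, a prime filter of \<open>S\<close> contains proper
  elements, so the congruence it gives has a nontrivial class of \<open>\<top>\<close>.
\<close>

lemma big_congruences: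
  "congruences S - congruences01 S =
    insert (nabla S) ((\<lambda>F. eq_of {F, carrier S - F}) ` SpecFilt S)"
proof (intro equalityI subsetI)
  fix \<theta> assume \<theta>: "\<theta> \<in> congruences S - congruences01 S"
  show "\<theta> \<in> insert (nabla S) ((\<lambda>F. eq_of {F, carrier S - F}) ` SpecFilt S)"
  proof (cases "\<theta> = nabla S")
    case False
    then obtain F where F: "F = X - {\<bottom>} \<or> F = Y - {\<bottom>}" "\<theta> = eq_of {F, carrier S - F}"
      using congruence_cases[OF \<theta> False] complement_bot complement_bot_Y by metis
    have "F \<subseteq> carrier S" "\<bottom> \<notin> F" "\<top> \<in> F"
      using F(1) X_sub Y_sub bounds_X bounds_Y bounds_distinct by (elim disjE; auto)+
    then have "F \<in> SpecFilt S"
      using eq_of_congruence_iff[OF bounded_lattice_axioms] F(2) \<theta> by blast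
    then show ?thesis using F(2) by blast
  qed simp
next
  fix \<theta> assume "\<theta> \<in> insert (nabla S) ((\<lambda>F. eq_of {F, carrier S - F}) ` SpecFilt S)"
  then consider "\<theta> = nabla S" | F where "F \<in> SpecFilt S" "\<theta> = eq_of {F, carrier S - F}"
    by blast
  then show "\<theta> \<in> congruences S - congruences01 S"
  proof cases
    case 1
    have "\<top> \<in> \<theta> `` {\<bottom>}" by (simp add: 1 nabla_def)
    then have "\<theta> `` {\<bottom>} \<noteq> {\<bottom>}" using bounds_distinct by (metis singletonD)
    then have "\<theta> \<notin> congruences01 S" by (simp add: congruences01_def)
    then show ?thesis using 1 nabla_congruence[OF lattice_axioms] by blast
  next
    case 2
    note b = SpecFilt_bounds[OF bounded_lattice_axioms 2(1)]
    have "F - {\<top>} \<noteq> {}"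
      using SpecFilt_cases[OF 2(1)] proper_X proper_Y by blast
    then have "\<theta> `` {\<top>} \<noteq> {\<top>}"
      using eq_of_block[OF b(1,2)] 2(2) by blast
    then have "\<theta> \<notin> congruences01 S" by (simp add: congruences01_def)
    then show ?thesis
      using eq_of_congruence_iff[OF bounded_lattice_axioms b(1,3,2)] 2 by blast
  qed
qed

text \<open>
  A congruence with trivial classes of the bounds relates no proper element of \<open>X\<close> to a proper
  element \<open>y\<close> of \<open>Y\<close>: meeting with \<open>y\<close> would give \<open>\<bottom> \<equiv> y\<close>.
\<close>

lemma congruence01_same_side:
  assumes \<theta>: "\<theta> \<in> congruences01 S" and uv: "(u, v) \<in> \<theta>"
  shows "u = v \<or> (u \<in> X - {\<bottom>, \<top>} \<and> v \<in> X - {\<bottom>, \<top>}) \<or> (u \<in> Y - {\<bottom>, \<top>} \<and> v \<in> Y - {\<bottom>, \<top>})"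
proof -
  have con: "\<theta> \<in> congruences S" and trivial: "\<theta> `` {\<bottom>} = {\<bottom>}" "\<theta> `` {\<top>} = {\<top>}"
    using \<theta> by (simp_all add: congruences01_def)
  have no_cross: False
    if x: "x \<in> X - {\<bottom>, \<top>}" and y: "y \<in> Y - {\<bottom>, \<top>}" and xy: "(x, y) \<in> \<theta>" for x y
  proof -
    have "y \<in> carrier S" using y Y_sub by blast
    moreover from this have "y \<sqinter> y = y" by (intro meet_eqI) auto
    ultimately have "(\<bottom>, y) \<in> \<theta>"
      using congruencesD(7)[OF con xy congruencesD(3)[OF con]] mixed_meet[OF x y] by metis
    then show False using trivial(1) y by blast
  qed
  show ?thesis
  proof (cases "u \<in> {\<bottom>, \<top>} \<or> v \<in> {\<bottom>, \<top>}")
    case True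
    have "v \<in> \<theta> `` {u}" "u \<in> \<theta> `` {v}" using uv congruencesD(4)[OF con uv] by simp_all
    then have "u = v" using True trivial by (elim disjE insertE) simp_all
    then show ?thesis ..
  next
    case False
    moreover have "u \<in> X \<union> Y" "v \<in> X \<union> Y"
      using congruencesD(1,2)[OF con uv] carrier_eq by simp_all
    ultimately show ?thesis
      using no_cross[OF _ _ uv] no_cross[OF _ _ congruencesD(4)[OF con uv]] by blast
  qed
qed

text \<open>
  Related elements that are distinct are proper and on the same side, so they lie in the same block
  of each of the two possible two-block partitions.
\<close>

lemma congruence01_le_big:
  assumes \<theta>: "\<theta> \<in> congruences01 S" and \<psi>: "\<psi> \<in> congruences S - congruences01 S"
  shows "\<theta> \<subseteq> \<psi>"
proof (rule subrelI)
  fix u v assume uv: "(u, v) \<in> \<theta>"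
  have S: "u \<in> carrier S" "v \<in> carrier S"
    using \<theta> congruencesD(1,2)[OF _ uv] by (simp_all add: congruences01_def)
  have "\<psi> = nabla S \<or> \<psi> = eq_of {X - {\<bottom>}, Y - {\<top>}} \<or> \<psi> = eq_of {Y - {\<bottom>}, X - {\<top>}}"
    using congruence_cases[OF \<psi>] by blast
  then show "(u, v) \<in> \<psi>"
  proof (elim disjE)
    show "(u, v) \<in> \<psi>" if "\<psi> = nabla S" using that S by (simp add: nabla_def)
  qed (use congruence01_same_side[OF \<theta> uv] \<psi> S congruencesD(3)[of \<psi> S u] in
      \<open>simp add: eq_of_def; blast\<close>)+
qed

end

section \<open>Horizontal sums by embeddings\<close>

lemma bounded_lattice_dual:
  assumes "bounded_lattice L"
  shows "bounded_lattice (inv_gorder L)"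
proof -
  interpret bounded_lattice L by fact
  interpret D: lattice "inv_gorder L" by (rule dual_lattice)
  show ?thesis
    by unfold_locales
      (use bottom_exists top_exists in \<open>simp_all add: least_def greatest_def\<close>)
qed

text \<open>
  Horizontal sums up to isomorphism, with the two summands embedded by \<open>i\<close> and \<open>j\<close>. The conditions
  are invariant under exchanging the summands and under reversing all orders, so that each
  statement needs to be proved for one summand and one of the two operations only.
\<close>

locale horizontal_sum = A: bounded_lattice A + B: bounded_lattice B
  for A :: "'a gorder" and B :: "'b gorder" +
  fixes S :: "'c gorder" and i :: "'a \<Rightarrow> 'c" and j :: "'b \<Rightarrow> 'c"
  assumes carrier_S: "carrier S = i ` carrier A \<union> j ` carrier B"
    and eq_S: "eq S = (=)"
    and le_S: "x \<sqsubseteq>\<^bsub>S\<^esub> y \<longleftrightarrow>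
      (\<exists>a\<in>carrier A. \<exists>a'\<in>carrier A. x = i a \<and> y = i a' \<and> a \<sqsubseteq>\<^bsub>A\<^esub> a') \<or>
      (\<exists>b\<in>carrier B. \<exists>b'\<in>carrier B. x = j b \<and> y = j b' \<and> b \<sqsubseteq>\<^bsub>B\<^esub> b')"
    and inj_i: "inj_on i (carrier A)"
    and inj_j: "inj_on j (carrier B)"
    and glue: "a \<in> carrier A \<Longrightarrow> b \<in> carrier B \<Longrightarrow>
      i a = j b \<longleftrightarrow> a = \<bottom>\<^bsub>A\<^esub> \<and> b = \<bottom>\<^bsub>B\<^esub> \<or> a = \<top>\<^bsub>A\<^esub> \<and> b = \<top>\<^bsub>B\<^esub>"
    and proper_A: "\<exists>a\<in>carrier A. a \<noteq> \<bottom>\<^bsub>A\<^esub> \<and> a \<noteq> \<top>\<^bsub>A\<^esub>"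
    and proper_B: "\<exists>b\<in>carrier B. b \<noteq> \<bottom>\<^bsub>B\<^esub> \<and> b \<noteq> \<top>\<^bsub>B\<^esub>"
begin

lemma swap: "horizontal_sum B A S j i"
proof (intro horizontal_sum.intro horizontal_sum_axioms.intro)
  show "j b = i a \<longleftrightarrow> b = \<bottom>\<^bsub>B\<^esub> \<and> a = \<bottom>\<^bsub>A\<^esub> \<or> b = \<top>\<^bsub>B\<^esub> \<and> a = \<top>\<^bsub>A\<^esub>"
    if "b \<in> carrier B" "a \<in> carrier A" for a b
    using glue[OF that(2,1)] by metis
qed (rule A.bounded_lattice_axioms B.bounded_lattice_axioms inj_i inj_j eq_S proper_A proper_B
    carrier_S[unfolded Un_commute[of "i ` _"]] le_S[unfolded disj_commute[of "\<exists>a\<in>carrier A. _ a"]])+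

lemma dual: "horizontal_sum (inv_gorder A) (inv_gorder B) (inv_gorder S) i j"
proof (intro horizontal_sum.intro horizontal_sum_axioms.intro)
  show "x \<sqsubseteq>\<^bsub>inv_gorder S\<^esub> y \<longleftrightarrow>
      (\<exists>a\<in>carrier (inv_gorder A). \<exists>a'\<in>carrier (inv_gorder A).
        x = i a \<and> y = i a' \<and> a \<sqsubseteq>\<^bsub>inv_gorder A\<^esub> a') \<or>
      (\<exists>b\<in>carrier (inv_gorder B). \<exists>b'\<in>carrier (inv_gorder B).
        x = j b \<and> y = j b' \<and> b \<sqsubseteq>\<^bsub>inv_gorder B\<^esub> b')" for x y
    using le_S[of y x] by simp blast
  show "i a = j b \<longleftrightarrow> a = \<bottom>\<^bsub>inv_gorder A\<^esub> \<and> b = \<bottom>\<^bsub>inv_gorder B\<^esub> \<or>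
      a = \<top>\<^bsub>inv_gorder A\<^esub> \<and> b = \<top>\<^bsub>inv_gorder B\<^esub>"
    if "a \<in> carrier (inv_gorder A)" "b \<in> carrier (inv_gorder B)" for a b
    using glue[of a b] that by auto
qed (use carrier_S eq_S inj_i inj_j proper_A proper_B
    bounded_lattice_dual[OF A.bounded_lattice_axioms]
    bounded_lattice_dual[OF B.bounded_lattice_axioms] in auto)

lemma nontrivial_A: "\<bottom>\<^bsub>A\<^esub> \<noteq> \<top>\<^bsub>A\<^esub>"
  using proper_A A.bot_neq_top by blast

lemma le_bot_A: "a \<in> carrier A \<Longrightarrow> a \<sqsubseteq>\<^bsub>A\<^esub> \<bottom>\<^bsub>A\<^esub> \<longleftrightarrow> a = \<bottom>\<^bsub>A\<^esub>"
  using A.le_antisym[OF _ A.bottom_lower _ A.bottom_closed] A.bottom_lower by metis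

lemma top_le_A: "a \<in> carrier A \<Longrightarrow> \<top>\<^bsub>A\<^esub> \<sqsubseteq>\<^bsub>A\<^esub> a \<longleftrightarrow> a = \<top>\<^bsub>A\<^esub>"
  using A.le_antisym[OF A.top_higher _ _ A.top_closed] A.top_higher by metis

lemma i_eq_iff: "a \<in> carrier A \<Longrightarrow> a' \<in> carrier A \<Longrightarrow> i a = i a' \<longleftrightarrow> a = a'"
  using inj_on_eq_iff[OF inj_i] .

lemma i_bot: "i \<bottom>\<^bsub>A\<^esub> = j \<bottom>\<^bsub>B\<^esub>" and i_top: "i \<top>\<^bsub>A\<^esub> = j \<top>\<^bsub>B\<^esub>"
  using glue[OF A.bottom_closed B.bottom_closed] glue[OF A.top_closed B.top_closed] by simp_all

lemma le_ii:
  assumes a: "a \<in> carrier A" "a' \<in> carrier A"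
  shows "i a \<sqsubseteq>\<^bsub>S\<^esub> i a' \<longleftrightarrow> a \<sqsubseteq>\<^bsub>A\<^esub> a'"
proof
  assume "i a \<sqsubseteq>\<^bsub>S\<^esub> i a'"
  then consider (A) c c' where "c \<in> carrier A" "c' \<in> carrier A" "i a = i c" "i a' = i c'" "c \<sqsubseteq>\<^bsub>A\<^esub> c'"
    | (B) b b' where "b \<in> carrier B" "b' \<in> carrier B" "i a = j b" "i a' = j b'" "b \<sqsubseteq>\<^bsub>B\<^esub> b'"
    unfolding le_S by blast
  then show "a \<sqsubseteq>\<^bsub>A\<^esub> a'"
  proof cases
    case A
    then show ?thesis using a by (simp add: i_eq_iff)
  next
    case B
    have "a = \<bottom>\<^bsub>A\<^esub> \<or> a' = \<top>\<^bsub>A\<^esub> \<or> a = \<top>\<^bsub>A\<^esub> \<and> a' = \<bottom>\<^bsub>A\<^esub> \<and> \<top>\<^bsub>B\<^esub> \<sqsubseteq>\<^bsub>B\<^esub> \<bottom>\<^bsub>B\<^esub>"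
      using glue[OF a(1) B(1)] glue[OF a(2) B(2)] B(3-5) by metis
    moreover have "\<not> \<top>\<^bsub>B\<^esub> \<sqsubseteq>\<^bsub>B\<^esub> \<bottom>\<^bsub>B\<^esub>"
      using horizontal_sum.le_bot_A[OF swap] horizontal_sum.nontrivial_A[OF swap] B.top_closed
      by metis
    ultimately show ?thesis using a A.bottom_lower A.top_higher by metis
  qed
next
  assume "a \<sqsubseteq>\<^bsub>A\<^esub> a'"
  then show "i a \<sqsubseteq>\<^bsub>S\<^esub> i a'" unfolding le_S using a by blast
qed

text \<open>
  The sets \<open>i ` A\<close> and \<open>j ` B\<close> share the bounds only, so a comparison between \<open>i a\<close> and \<open>j b\<close> takes
  place at a bound.
\<close>

lemma le_ij:
  assumes a: "a \<in> carrier A" and b: "b \<in> carrier B"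
  shows "i a \<sqsubseteq>\<^bsub>S\<^esub> j b \<longleftrightarrow> a = \<bottom>\<^bsub>A\<^esub> \<or> b = \<top>\<^bsub>B\<^esub>"
proof
  assume "i a \<sqsubseteq>\<^bsub>S\<^esub> j b"
  then consider (A) c c' where "c \<in> carrier A" "c' \<in> carrier A" "i a = i c" "j b = i c'" "c \<sqsubseteq>\<^bsub>A\<^esub> c'"
    | (B) d d' where "d \<in> carrier B" "d' \<in> carrier B" "i a = j d" "j b = j d'" "d \<sqsubseteq>\<^bsub>B\<^esub> d'"
    unfolding le_S by blast
  then show "a = \<bottom>\<^bsub>A\<^esub> \<or> b = \<top>\<^bsub>B\<^esub>"
  proof cases
    case A
    then show ?thesis using glue[OF A(2) b] a le_bot_A[of a] by (metis i_eq_iff)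
  next
    case B
    then show ?thesis
      using glue[OF a B(1)] b horizontal_sum.top_le_A[OF swap, of b]
      by (metis horizontal_sum.i_eq_iff[OF swap])
  qed
next
  assume "a = \<bottom>\<^bsub>A\<^esub> \<or> b = \<top>\<^bsub>B\<^esub>"
  then show "i a \<sqsubseteq>\<^bsub>S\<^esub> j b"
  proof
    assume "a = \<bottom>\<^bsub>A\<^esub>"
    then show ?thesis
      using horizontal_sum.le_ii[OF swap B.bottom_closed b] b by (simp add: i_bot)
  next
    assume "b = \<top>\<^bsub>B\<^esub>"
    then show ?thesis using le_ii[OF a A.top_closed] a by (simp flip: i_top)
  qed
qed

lemmas j_eq_iff = horizontal_sum.i_eq_iff[OF swap]
lemmas le_jj = horizontal_sum.le_ii[OF swap]
lemmas le_ji = horizontal_sum.le_ij[OF swap]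
lemmas top_le_B = horizontal_sum.top_le_A[OF swap]
lemmas nontrivial_B = horizontal_sum.nontrivial_A[OF swap]

lemma S_cases:
  assumes "x \<in> carrier S"
  obtains (A) a where "a \<in> carrier A" "x = i a" | (B) b where "b \<in> carrier B" "x = j b"
  using assms carrier_S by blast

lemma le_i_trans:
  assumes a: "a \<in> carrier A" and y: "y \<in> carrier S" "i a \<sqsubseteq>\<^bsub>S\<^esub> y"
    and z: "z \<in> carrier S" "y \<sqsubseteq>\<^bsub>S\<^esub> z"
  shows "i a \<sqsubseteq>\<^bsub>S\<^esub> z"
  using z(1)
proof (cases z rule: S_cases)
  case (A c)
  note c = A
  show ?thesis
    using y(1)
  proof (cases y rule: S_cases)
    case (A d)
    then show ?thesis using a c y z A.le_trans[of a d c] by (simp add: le_ii)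
  next
    case (B d)
    then have "a = \<bottom>\<^bsub>A\<^esub> \<or> c = \<top>\<^bsub>A\<^esub>"
      using a c y z nontrivial_B by (auto simp: le_ij le_ji)
    then show ?thesis using a c by (auto simp: le_ii)
  qed
next
  case (B c)
  note c = B
  show ?thesis
    using y(1)
  proof (cases y rule: S_cases)
    case (A d)
    then show ?thesis using a c y z by (auto simp: le_ii le_ij le_bot_A)
  next
    case (B d)
    then show ?thesis using a c y z by (auto simp: le_jj le_ij top_le_B)
  qed
qed

lemma partial_order_S: "partial_order S"
proof
  fix x y z
  show "x .=\<^bsub>S\<^esub> y" if xy: "x \<sqsubseteq>\<^bsub>S\<^esub> y" "y \<sqsubseteq>\<^bsub>S\<^esub> x" "x \<in> carrier S" "y \<in> carrier S"
    using that(3)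
  proof (cases x rule: S_cases)
    case (A a)
    note a = A
    show ?thesis
      using that(4)
    proof (cases y rule: S_cases)
      case (A a')
      then show ?thesis using a xy A.le_antisym[of a a'] by (simp add: le_ii eq_S)
    next
      case (B b)
      then show ?thesis using a xy nontrivial_A nontrivial_B i_bot i_top
        by (metis le_ij le_ji eq_S)
    qed
  next
    case (B b)
    note b = B
    show ?thesis
      using that(4)
    proof (cases y rule: S_cases)
      case (A a)
      then show ?thesis using b xy nontrivial_A nontrivial_B i_bot i_top
        by (metis le_ij le_ji eq_S)
    next
      case (B b')
      then show ?thesis using b xy B.le_antisym[of b b'] by (simp add: le_jj eq_S)
    qed
  qed
  show "x \<sqsubseteq>\<^bsub>S\<^esub> z"
    if "x \<sqsubseteq>\<^bsub>S\<^esub> y" "y \<sqsubseteq>\<^bsub>S\<^esub> z" "x \<in> carrier S" "y \<in> carrier S" "z \<in> carrier S"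
    using that(3)
  proof (cases x rule: S_cases)
    case (A a)
    then show ?thesis using le_i_trans[of a y z] that by simp
  next
    case (B b)
    then show ?thesis using horizontal_sum.le_i_trans[OF swap, of b y z] that by simp
  qed
  show "x \<sqsubseteq>\<^bsub>S\<^esub> x" if "x \<in> carrier S"
    using that by (cases x rule: S_cases) (simp_all add: le_ii le_jj)
qed (simp_all add: eq_S)

lemma sup_ii:
  assumes a: "a \<in> carrier A" "a' \<in> carrier A" and u: "u \<in> carrier S" "i a \<sqsubseteq>\<^bsub>S\<^esub> u" "i a' \<sqsubseteq>\<^bsub>S\<^esub> u"
  shows "i (a \<squnion>\<^bsub>A\<^esub> a') \<sqsubseteq>\<^bsub>S\<^esub> u"
  using u(1)
proof (cases u rule: S_cases)
  case (A c)
  then show ?thesis using a u by (simp add: le_ii A.join_le)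
next
  case (B b)
  have "a \<squnion>\<^bsub>A\<^esub> a' = \<bottom>\<^bsub>A\<^esub>" if "b \<noteq> \<top>\<^bsub>B\<^esub>"
    using that a u B by (simp add: le_ij)
  then show ?thesis using a B by (auto simp: le_ij)
qed

lemma sup_ij:
  assumes a: "a \<in> carrier A" "a \<noteq> \<bottom>\<^bsub>A\<^esub>" and b: "b \<in> carrier B" "b \<noteq> \<bottom>\<^bsub>B\<^esub>"
    and u: "u \<in> carrier S" "i a \<sqsubseteq>\<^bsub>S\<^esub> u" "j b \<sqsubseteq>\<^bsub>S\<^esub> u"
  shows "u = i \<top>\<^bsub>A\<^esub>"
  using u(1)
proof (cases u rule: S_cases)
  case (A c)
  then show ?thesis using b u by (simp add: le_ji)
next
  case (B c)
  then show ?thesis using a u by (simp add: le_ij i_top)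
qed

lemma i_in_S: "a \<in> carrier A \<Longrightarrow> i a \<in> carrier S"
  using carrier_S by blast

lemmas j_in_S = horizontal_sum.i_in_S[OF swap]

text \<open>
  Joins within a summand are computed there, because an upper bound from outside the summand
  forces a bound. For proper elements of different summands, \<open>1\<close> is the only upper bound.
\<close>

lemma join_exists_S:
  assumes xy: "x \<in> carrier S" "y \<in> carrier S"
  shows "\<exists>s\<in>carrier S. x \<sqsubseteq>\<^bsub>S\<^esub> s \<and> y \<sqsubseteq>\<^bsub>S\<^esub> s \<and>
    (\<forall>u\<in>carrier S. x \<sqsubseteq>\<^bsub>S\<^esub> u \<longrightarrow> y \<sqsubseteq>\<^bsub>S\<^esub> u \<longrightarrow> s \<sqsubseteq>\<^bsub>S\<^esub> u)" (is "?sup x y")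
proof -
  have AA: "?sup (i a) (i a')" if "a \<in> carrier A" "a' \<in> carrier A" for a a'
    using that sup_ii[OF that]
    by (intro bexI[of _ "i (a \<squnion>\<^bsub>A\<^esub> a')"]) (simp_all add: le_ii A.join_left A.join_right i_in_S)
  have BB: "?sup (j b) (j b')" if "b \<in> carrier B" "b' \<in> carrier B" for b b'
    using that horizontal_sum.sup_ii[OF swap that] j_in_S
    by (intro bexI[of _ "j (b \<squnion>\<^bsub>B\<^esub> b')"]) (simp_all add: le_jj B.join_left B.join_right)
  have AB: "?sup (i a) (j b)" if ab: "a \<in> carrier A" "b \<in> carrier B" for a b
  proof (cases "a = \<bottom>\<^bsub>A\<^esub> \<or> b = \<bottom>\<^bsub>B\<^esub>")
    case True
    then show ?thesis
      using AA[OF ab(1) A.bottom_closed] BB[OF B.bottom_closed ab(2)] by (metis i_bot)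
  next
    case False
    have top: "x \<sqsubseteq>\<^bsub>S\<^esub> i \<top>\<^bsub>A\<^esub>" if "x \<in> carrier S" for x
      using that by (cases x rule: S_cases) (simp_all add: le_ii le_ji)
    have "u = i \<top>\<^bsub>A\<^esub>" if "u \<in> carrier S" "i a \<sqsubseteq>\<^bsub>S\<^esub> u" "j b \<sqsubseteq>\<^bsub>S\<^esub> u" for u
      using sup_ij[OF ab(1) _ ab(2)] that False by blast
    then show ?thesis
      using top i_in_S[OF A.top_closed] i_in_S[OF ab(1)] j_in_S[OF ab(2)]
      by (intro bexI[of _ "i \<top>\<^bsub>A\<^esub>"]) metis+
  qed
  have BA: "?sup (j b) (i a)" if ab: "a \<in> carrier A" "b \<in> carrier B" for a b
    using AB[OF ab] by blast
  show ?thesis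
    using xy by (elim S_cases; hypsubst) (rule AA BB AB BA; assumption)+
qed

lemma lattice_S: "lattice S"
proof (rule lattice_of_bounds[OF partial_order_S join_exists_S])
  fix x y assume "x \<in> carrier S" "y \<in> carrier S"
  then show "\<exists>s\<in>carrier S. s \<sqsubseteq>\<^bsub>S\<^esub> x \<and> s \<sqsubseteq>\<^bsub>S\<^esub> y \<and>
    (\<forall>u\<in>carrier S. u \<sqsubseteq>\<^bsub>S\<^esub> x \<longrightarrow> u \<sqsubseteq>\<^bsub>S\<^esub> y \<longrightarrow> u \<sqsubseteq>\<^bsub>S\<^esub> s)"
    using horizontal_sum.join_exists_S[OF dual, of x y] by simp
qed

lemma S_bounds:
  assumes "x \<in> carrier S"
  shows "i \<bottom>\<^bsub>A\<^esub> \<sqsubseteq>\<^bsub>S\<^esub> x" "x \<sqsubseteq>\<^bsub>S\<^esub> i \<top>\<^bsub>A\<^esub>"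
  using assms by (cases x rule: S_cases; simp add: le_ii le_ij le_ji)+

lemma bounded_lattice_S: "bounded_lattice S"
proof -
  interpret lattice S by (rule lattice_S)
  show ?thesis
  proof
    show "\<exists>b. least S b (carrier S)"
      using S_bounds i_in_S[OF A.bottom_closed] unfolding least_def by blast
    show "\<exists>t. greatest S t (carrier S)"
      using S_bounds i_in_S[OF A.top_closed] unfolding greatest_def by blast
  qed
qed

sublocale S: bounded_lattice S
  by (rule bounded_lattice_S)

lemma bot_S: "\<bottom>\<^bsub>S\<^esub> = i \<bottom>\<^bsub>A\<^esub>" and top_S: "\<top>\<^bsub>S\<^esub> = i \<top>\<^bsub>A\<^esub>"
  using S.bottom_eq[of "i \<bottom>\<^bsub>A\<^esub>"] S.top_eq[of "i \<top>\<^bsub>A\<^esub>"] S_bounds i_in_S by simp_all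

lemma join_ii:
  assumes a: "a \<in> carrier A" "a' \<in> carrier A"
  shows "i a \<squnion>\<^bsub>S\<^esub> i a' = i (a \<squnion>\<^bsub>A\<^esub> a')"
  using sup_ii[OF a] a
  by (intro S.join_eqI) (simp_all add: le_ii A.join_left A.join_right i_in_S)

lemma meet_ii:
  assumes a: "a \<in> carrier A" "a' \<in> carrier A"
  shows "i a \<sqinter>\<^bsub>S\<^esub> i a' = i (a \<sqinter>\<^bsub>A\<^esub> a')"
  using horizontal_sum.join_ii[OF dual, of a a'] a by simp

lemma join_ij:
  assumes a: "a \<in> carrier A" "a \<noteq> \<bottom>\<^bsub>A\<^esub>" and b: "b \<in> carrier B" "b \<noteq> \<bottom>\<^bsub>B\<^esub>"
  shows "i a \<squnion>\<^bsub>S\<^esub> j b = \<top>\<^bsub>S\<^esub>"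
  using sup_ij[OF a b S.join_closed S.join_left S.join_right] a b
    i_in_S[OF a(1)] j_in_S[OF b(1)]
  by (simp add: top_S)

lemma meet_ij:
  assumes a: "a \<in> carrier A" "a \<noteq> \<top>\<^bsub>A\<^esub>" and b: "b \<in> carrier B" "b \<noteq> \<top>\<^bsub>B\<^esub>"
  shows "i a \<sqinter>\<^bsub>S\<^esub> j b = \<bottom>\<^bsub>S\<^esub>"
  using horizontal_sum.join_ij[OF dual, of a b] a b by simp

lemma union: "horizontal_union S (i ` carrier A) (j ` carrier B)"
proof
  show "carrier S = i ` carrier A \<union> j ` carrier B" by (rule carrier_S)
  show "i ` carrier A \<inter> j ` carrier B = {\<bottom>\<^bsub>S\<^esub>, \<top>\<^bsub>S\<^esub>}"
  proof (intro equalityI subsetI)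
    fix x assume "x \<in> i ` carrier A \<inter> j ` carrier B"
    then obtain a b where "a \<in> carrier A" "b \<in> carrier B" "x = i a" "i a = j b" by auto
    then show "x \<in> {\<bottom>\<^bsub>S\<^esub>, \<top>\<^bsub>S\<^esub>}" using glue[of a b] bot_S top_S by auto
  next
    fix x assume "x \<in> {\<bottom>\<^bsub>S\<^esub>, \<top>\<^bsub>S\<^esub>}"
    moreover have "\<bottom>\<^bsub>S\<^esub> \<in> i ` carrier A \<inter> j ` carrier B"
      using imageI[OF A.bottom_closed, of i] imageI[OF B.bottom_closed, of j]
      by (simp add: bot_S i_bot)
    moreover have "\<top>\<^bsub>S\<^esub> \<in> i ` carrier A \<inter> j ` carrier B"
      using imageI[OF A.top_closed, of i] imageI[OF B.top_closed, of j]
      by (simp add: top_S i_top)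
    ultimately show "x \<in> i ` carrier A \<inter> j ` carrier B" by blast
  qed
  show "i ` carrier A - {\<bottom>\<^bsub>S\<^esub>, \<top>\<^bsub>S\<^esub>} \<noteq> {}"
  proof -
    obtain a where a: "a \<in> carrier A" "a \<noteq> \<bottom>\<^bsub>A\<^esub>" "a \<noteq> \<top>\<^bsub>A\<^esub>" using proper_A by blast
    then have "i a \<noteq> \<bottom>\<^bsub>S\<^esub>" "i a \<noteq> \<top>\<^bsub>S\<^esub>" by (simp_all add: bot_S top_S i_eq_iff)
    then show ?thesis using a(1) by blast
  qed
  show "j ` carrier B - {\<bottom>\<^bsub>S\<^esub>, \<top>\<^bsub>S\<^esub>} \<noteq> {}"
  proof -
    obtain b where b: "b \<in> carrier B" "b \<noteq> \<bottom>\<^bsub>B\<^esub>" "b \<noteq> \<top>\<^bsub>B\<^esub>" using proper_B by blast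
    then have "j b \<noteq> \<bottom>\<^bsub>S\<^esub>" "j b \<noteq> \<top>\<^bsub>S\<^esub>"
      by (simp_all add: bot_S top_S i_bot i_top j_eq_iff)
    then show ?thesis using b(1) by blast
  qed
  fix x y
  assume x: "x \<in> i ` carrier A - {\<bottom>\<^bsub>S\<^esub>, \<top>\<^bsub>S\<^esub>}" and y: "y \<in> j ` carrier B - {\<bottom>\<^bsub>S\<^esub>, \<top>\<^bsub>S\<^esub>}"
  obtain a where a: "a \<in> carrier A" "x = i a" "a \<noteq> \<bottom>\<^bsub>A\<^esub>" "a \<noteq> \<top>\<^bsub>A\<^esub>"
    using x bot_S top_S by auto
  obtain b where b: "b \<in> carrier B" "y = j b" "b \<noteq> \<bottom>\<^bsub>B\<^esub>" "b \<noteq> \<top>\<^bsub>B\<^esub>"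
    using y bot_S top_S i_bot i_top by auto
  show "x \<squnion>\<^bsub>S\<^esub> y = \<top>\<^bsub>S\<^esub>" "x \<sqinter>\<^bsub>S\<^esub> y = \<bottom>\<^bsub>S\<^esub>"
    using join_ij[OF a(1,3) b(1,3)] meet_ij[OF a(1,4) b(1,4)] a b by simp_all
qed

sublocale U: horizontal_union S "i ` carrier A" "j ` carrier B"
  by (rule union)

text \<open>
  The complement of \<open>A \<setminus> {0}\<close> in the sum is \<open>B \<setminus> {1}\<close>. So closure under meets is a condition on
  \<open>A\<close>, and primeness is a condition on \<open>B\<close>.
\<close>

lemma SpecFilt_i_iff:
  "i ` carrier A - {\<bottom>\<^bsub>S\<^esub>} \<in> SpecFilt S \<longleftrightarrow> bot_meet_irreducible A \<and> top_join_irreducible B"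
  (is "?F \<in> _ \<longleftrightarrow> _")
proof -
  have i_F: "i a \<in> ?F \<longleftrightarrow> a \<noteq> \<bottom>\<^bsub>A\<^esub>" if "a \<in> carrier A" for a
    using that i_eq_iff[OF that A.bottom_closed] by (simp add: bot_S)
  have j_F: "j b \<in> ?F \<longleftrightarrow> b = \<top>\<^bsub>B\<^esub>" if "b \<in> carrier B" for b
  proof -
    have "j b \<in> carrier S - ?F \<longleftrightarrow> b \<noteq> \<top>\<^bsub>B\<^esub>"
      using that j_eq_iff[OF that B.top_closed] unfolding U.complement_bot
      by (simp add: top_S i_top)
    then show ?thesis using U.Y_sub[of "j b"] that by blast
  qed
  show ?thesis
  proof (intro iffI conjI)
    assume F: "?F \<in> SpecFilt S"
    show "bot_meet_irreducible A"
      unfolding bot_meet_irreducible_def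
    proof (intro ballI impI)
      fix a a' assume a: "a \<in> carrier A" "a' \<in> carrier A" "a \<sqinter>\<^bsub>A\<^esub> a' = \<bottom>\<^bsub>A\<^esub>"
      then have "i a \<sqinter>\<^bsub>S\<^esub> i a' \<notin> ?F" using i_F[OF A.bottom_closed] by (simp add: meet_ii)
      then show "a = \<bottom>\<^bsub>A\<^esub> \<or> a' = \<bottom>\<^bsub>A\<^esub>"
        using SpecFiltD(2)[OF F] i_F a by blast
    qed
    show "top_join_irreducible B"
      unfolding top_join_irreducible_def
    proof (intro ballI impI)
      fix b b' assume b: "b \<in> carrier B" "b' \<in> carrier B" "b \<squnion>\<^bsub>B\<^esub> b' = \<top>\<^bsub>B\<^esub>"
      then have "j b \<squnion>\<^bsub>S\<^esub> j b' \<in> ?F"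
        using j_F[OF B.top_closed] horizontal_sum.join_ii[OF swap b(1,2)] by simp
      then show "b = \<top>\<^bsub>B\<^esub> \<or> b' = \<top>\<^bsub>B\<^esub>"
        using SpecFiltD(4)[OF F j_in_S[OF b(1)] j_in_S[OF b(2)]] j_F[OF b(1)] j_F[OF b(2)] by blast
    qed
  next
    assume irr: "bot_meet_irreducible A \<and> top_join_irreducible B"
    have not_F: "\<exists>b\<in>carrier B. x = j b \<and> b \<noteq> \<top>\<^bsub>B\<^esub>" if "x \<in> carrier S" "x \<notin> ?F" for x
    proof -
      have "x \<in> j ` carrier B - {\<top>\<^bsub>S\<^esub>}" using that U.complement_bot by blast
      then show ?thesis using top_S i_top by auto
    qed
    show "?F \<in> SpecFilt S"
    proof (rule SpecFiltI)
      show "?F \<subseteq> carrier S" using U.X_sub by blast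
      show "\<bottom>\<^bsub>S\<^esub> \<in> carrier S" "\<bottom>\<^bsub>S\<^esub> \<notin> ?F" by simp_all
      show "\<top>\<^bsub>S\<^esub> \<in> ?F" using U.bounds_X U.bounds_distinct by simp
    next
      fix x y assume "x \<in> ?F" "y \<in> ?F"
      then obtain a a' where a: "a \<in> carrier A" "x = i a" "a' \<in> carrier A" "y = i a'"
          "a \<noteq> \<bottom>\<^bsub>A\<^esub>" "a' \<noteq> \<bottom>\<^bsub>A\<^esub>"
        using bot_S by auto
      then have "a \<sqinter>\<^bsub>A\<^esub> a' \<noteq> \<bottom>\<^bsub>A\<^esub>" using irr unfolding bot_meet_irreducible_def by metis
      then show "x \<sqinter>\<^bsub>S\<^esub> y \<in> ?F" using a i_F[of "a \<sqinter>\<^bsub>A\<^esub> a'"] by (simp add: meet_ii)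
    next
      fix x y assume xy: "x \<in> ?F" "y \<in> carrier S" "x \<sqsubseteq>\<^bsub>S\<^esub> y"
      obtain a where a: "a \<in> carrier A" "x = i a" "a \<noteq> \<bottom>\<^bsub>A\<^esub>"
        using xy(1) bot_S by auto
      show "y \<in> ?F"
      proof (rule ccontr)
        assume "y \<notin> ?F"
        then obtain b where "b \<in> carrier B" "y = j b" "b \<noteq> \<top>\<^bsub>B\<^esub>"
          using not_F xy(2) by blast
        then show False using le_ij a xy(3) by simp
      qed
    next
      fix x y assume xy: "x \<in> carrier S" "y \<in> carrier S" "x \<squnion>\<^bsub>S\<^esub> y \<in> ?F"
      show "x \<in> ?F \<or> y \<in> ?F"
      proof (rule ccontr)
        assume "\<not> (x \<in> ?F \<or> y \<in> ?F)"
        then obtain b b' where b: "b \<in> carrier B" "x = j b" "b \<noteq> \<top>\<^bsub>B\<^esub>"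
            "b' \<in> carrier B" "y = j b'" "b' \<noteq> \<top>\<^bsub>B\<^esub>"
          using not_F xy(1,2) by metis
        then have "b \<squnion>\<^bsub>B\<^esub> b' \<noteq> \<top>\<^bsub>B\<^esub>" using irr unfolding top_join_irreducible_def by metis
        then show False
          using xy(3) b j_F[of "b \<squnion>\<^bsub>B\<^esub> b'"] by (simp add: horizontal_sum.join_ii[OF swap])
      qed
    qed
  qed
qed

lemmas SpecFilt_j_iff = horizontal_sum.SpecFilt_i_iff[OF swap]

end

section \<open>Congruences with trivial classes of the bounds\<close>

definition glued :: "('a \<Rightarrow> 'c) \<Rightarrow> ('b \<Rightarrow> 'c) \<Rightarrow> 'a rel \<Rightarrow> 'b rel \<Rightarrow> 'c rel" where
  "glued i j \<theta> \<phi> = map_prod i i ` \<theta> \<union> map_prod j j ` \<phi>"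

definition pullback :: "('a \<Rightarrow> 'c) \<Rightarrow> 'a set \<Rightarrow> 'c rel \<Rightarrow> 'a rel" where
  "pullback i C \<psi> = {(a, a'). a \<in> C \<and> a' \<in> C \<and> (i a, i a') \<in> \<psi>}"

lemma glued_swap: "glued j i \<phi> \<theta> = glued i j \<theta> \<phi>"
  by (simp add: glued_def Un_commute)

lemma congruences01_dual: "congruences01 (inv_gorder L) = congruences01 L"
  unfolding congruences01_def congruences_def by auto

lemma congruences01D:
  assumes "\<theta> \<in> congruences01 L"
  shows "\<theta> \<in> congruences L"
    "(x, y) \<in> \<theta> \<Longrightarrow> x = \<bottom>\<^bsub>L\<^esub> \<longleftrightarrow> y = \<bottom>\<^bsub>L\<^esub>" "(x, y) \<in> \<theta> \<Longrightarrow> x = \<top>\<^bsub>L\<^esub> \<longleftrightarrow> y = \<top>\<^bsub>L\<^esub>"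
proof -
  show con: "\<theta> \<in> congruences L" using assms by (simp add: congruences01_def)
  have cl: "\<theta> `` {\<bottom>\<^bsub>L\<^esub>} = {\<bottom>\<^bsub>L\<^esub>}" "\<theta> `` {\<top>\<^bsub>L\<^esub>} = {\<top>\<^bsub>L\<^esub>}"
    using assms by (simp_all add: congruences01_def)
  assume xy: "(x, y) \<in> \<theta>"
  then have "y \<in> \<theta> `` {x}" "x \<in> \<theta> `` {y}" using congruencesD(4)[OF con] by simp_all
  then show "x = \<bottom>\<^bsub>L\<^esub> \<longleftrightarrow> y = \<bottom>\<^bsub>L\<^esub>" "x = \<top>\<^bsub>L\<^esub> \<longleftrightarrow> y = \<top>\<^bsub>L\<^esub>"
    using cl by (metis singletonD)+
qed

context horizontal_sum
begin

text \<open>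
  The two parts of a glued relation overlap in the bounds only, where both are trivial. Hence the
  class of a point of \<open>A\<close> is its class under \<open>\<theta>\<close>.
\<close>

lemma glued_i_iff:
  assumes \<theta>: "\<theta> \<in> congruences01 A" and \<phi>: "\<phi> \<in> congruences01 B" and a: "a \<in> carrier A"
  shows "(i a, y) \<in> glued i j \<theta> \<phi> \<longleftrightarrow> (\<exists>a'. y = i a' \<and> (a, a') \<in> \<theta>)"
proof
  note \<theta>D = congruencesD[OF congruences01D(1)[OF \<theta>]] and \<phi>D = congruencesD[OF congruences01D(1)[OF \<phi>]]
  assume "(i a, y) \<in> glued i j \<theta> \<phi>"
  then consider (A) c c' where "i a = i c" "y = i c'" "(c, c') \<in> \<theta>"
    | (B) b b' where "i a = j b" "y = j b'" "(b, b') \<in> \<phi>"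
    unfolding glued_def by auto
  then show "\<exists>a'. y = i a' \<and> (a, a') \<in> \<theta>"
  proof cases
    case A
    then show ?thesis using i_eq_iff[OF a] \<theta>D(1) by blast
  next
    case B
    have "b' = b"
      using glue[OF a \<phi>D(1)[OF B(3)]] B(1) congruences01D(2,3)[OF \<phi> B(3)] by metis
    then show ?thesis using B \<theta>D(3)[OF a] by metis
  qed
next
  assume "\<exists>a'. y = i a' \<and> (a, a') \<in> \<theta>"
  then show "(i a, y) \<in> glued i j \<theta> \<phi>" unfolding glued_def using map_prod_imageI by fast
qed

lemma glued_j_iff:
  assumes "\<theta> \<in> congruences01 A" "\<phi> \<in> congruences01 B" "b \<in> carrier B"
  shows "(j b, y) \<in> glued i j \<theta> \<phi> \<longleftrightarrow> (\<exists>b'. y = j b' \<and> (b, b') \<in> \<phi>)"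
  by (rule horizontal_sum.glued_i_iff[OF swap assms(2,1,3), unfolded glued_swap[of j i]])

text \<open>
  Besides monotonicity this says that gluing loses no information: each of the two congruences can be
  read off from the classes of the points of its summand.
\<close>

lemma glued_le_iff:
  assumes \<theta>: "\<theta> \<in> congruences01 A" "\<theta>' \<in> congruences01 A"
    and \<phi>: "\<phi> \<in> congruences01 B" "\<phi>' \<in> congruences01 B"
  shows "glued i j \<theta> \<phi> \<subseteq> glued i j \<theta>' \<phi>' \<longleftrightarrow> \<theta> \<subseteq> \<theta>' \<and> \<phi> \<subseteq> \<phi>'"
proof (intro iffI conjI subrelI)
  assume le: "glued i j \<theta> \<phi> \<subseteq> glued i j \<theta>' \<phi>'"
  show "(a, a') \<in> \<theta>'" if aa: "(a, a') \<in> \<theta>" for a a'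
  proof -
    have car: "a \<in> carrier A" "a' \<in> carrier A"
      using congruencesD(1,2)[OF congruences01D(1)[OF \<theta>(1)] aa] .
    have "(i a, i a') \<in> glued i j \<theta>' \<phi>'"
      using glued_i_iff[OF \<theta>(1) \<phi>(1) car(1)] aa le by blast
    then obtain c where "i a' = i c" "(a, c) \<in> \<theta>'"
      using glued_i_iff[OF \<theta>(2) \<phi>(2) car(1)] by blast
    then show ?thesis
      using i_eq_iff[OF car(2)] congruencesD(2)[OF congruences01D(1)[OF \<theta>(2)]] by blast
  qed
  show "(b, b') \<in> \<phi>'" if bb: "(b, b') \<in> \<phi>" for b b'
  proof -
    have car: "b \<in> carrier B" "b' \<in> carrier B"
      using congruencesD(1,2)[OF congruences01D(1)[OF \<phi>(1)] bb] .
    have "(j b, j b') \<in> glued i j \<theta>' \<phi>'"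
      using glued_j_iff[OF \<theta>(1) \<phi>(1) car(1)] bb le by blast
    then obtain c where "j b' = j c" "(b, c) \<in> \<phi>'"
      using glued_j_iff[OF \<theta>(2) \<phi>(2) car(1)] by blast
    then show ?thesis
      using j_eq_iff[OF car(2)] congruencesD(2)[OF congruences01D(1)[OF \<phi>(2)]] by blast
  qed
next
  fix x y assume "\<theta> \<subseteq> \<theta>' \<and> \<phi> \<subseteq> \<phi>'" "(x, y) \<in> glued i j \<theta> \<phi>"
  then show "(x, y) \<in> glued i j \<theta>' \<phi>'" unfolding glued_def by blast
qed

lemma glued_refl:
  assumes "\<theta> \<in> congruences01 A" "\<phi> \<in> congruences01 B" "x \<in> carrier S"
  shows "(x, x) \<in> glued i j \<theta> \<phi>"
  using assms(3)
proof (cases x rule: S_cases)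
  case (A a)
  then show ?thesis
    using glued_i_iff[OF assms(1,2)] congruencesD(3)[OF congruences01D(1)[OF assms(1)]] by blast
next
  case (B b)
  then show ?thesis
    using glued_j_iff[OF assms(1,2)] congruencesD(3)[OF congruences01D(1)[OF assms(2)]] by blast
qed

text \<open>
  Only a proper pair of \<open>\<theta>\<close> and a proper element \<open>y\<close> of \<open>B\<close> need an argument: both joins are \<open>1\<close>.
\<close>

lemma glued_join:
  assumes \<theta>: "\<theta> \<in> congruences01 A" and \<phi>: "\<phi> \<in> congruences01 B"
    and aa: "(a, a') \<in> \<theta>" and y: "y \<in> carrier S"
  shows "(i a \<squnion>\<^bsub>S\<^esub> y, i a' \<squnion>\<^bsub>S\<^esub> y) \<in> glued i j \<theta> \<phi>"
proof -
  note \<theta>D = congruencesD[OF congruences01D(1)[OF \<theta>]]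
  have car: "a \<in> carrier A" "a' \<in> carrier A" using \<theta>D(1,2)[OF aa] .
  have side: "(i a \<squnion>\<^bsub>S\<^esub> i c, i a' \<squnion>\<^bsub>S\<^esub> i c) \<in> glued i j \<theta> \<phi>" if "c \<in> carrier A" for c
    using \<theta>D(6)[OF aa \<theta>D(3)[OF that]] car that glued_i_iff[OF \<theta> \<phi>, of "a \<squnion>\<^bsub>A\<^esub> c"]
    by (simp add: join_ii) blast
  show ?thesis
    using y
  proof (cases y rule: S_cases)
    case (A c)
    then show ?thesis using side by simp
  next
    case (B b)
    consider "b = \<bottom>\<^bsub>B\<^esub>" | "a = a'" | "b \<noteq> \<bottom>\<^bsub>B\<^esub>" "a \<noteq> \<bottom>\<^bsub>A\<^esub>" "a' \<noteq> \<bottom>\<^bsub>A\<^esub>"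
      using congruences01D(2)[OF \<theta> aa] by metis
    then show ?thesis
    proof cases
      case 1
      then show ?thesis using side[OF A.bottom_closed] B by (simp add: i_bot)
    next
      case 2
      then show ?thesis using glued_refl[OF \<theta> \<phi>] y car i_in_S by simp
    next
      case 3
      then show ?thesis using glued_refl[OF \<theta> \<phi> S.top_closed] B car by (simp add: join_ij)
    qed
  qed
qed

lemma glued_meet:
  assumes "\<theta> \<in> congruences01 A" "\<phi> \<in> congruences01 B" "(a, a') \<in> \<theta>" "y \<in> carrier S"
  shows "(i a \<sqinter>\<^bsub>S\<^esub> y, i a' \<sqinter>\<^bsub>S\<^esub> y) \<in> glued i j \<theta> \<phi>"
  using horizontal_sum.glued_join[OF dual, of \<theta> \<phi> a a' y] assms by (simp add: congruences01_dual)

lemma glued_congruence: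
  assumes \<theta>: "\<theta> \<in> congruences01 A" and \<phi>: "\<phi> \<in> congruences01 B"
  shows "glued i j \<theta> \<phi> \<in> congruences01 S" (is "?R \<in> _")
proof -
  note \<theta>D = congruencesD[OF congruences01D(1)[OF \<theta>]] and \<phi>D = congruencesD[OF congruences01D(1)[OF \<phi>]]
  have R_cases: "(\<exists>a a'. x = i a \<and> y = i a' \<and> (a, a') \<in> \<theta>) \<or> (\<exists>b b'. x = j b \<and> y = j b' \<and> (b, b') \<in> \<phi>)"
    if "(x, y) \<in> ?R" for x y
    using that unfolding glued_def by auto
  have "?R \<in> congruences S"
  proof (rule congruencesI[OF lattice_S])
    show "equiv (carrier S) ?R"
    proof (rule equivI)
      show "?R \<subseteq> carrier S \<times> carrier S"
      proof (rule subrelI)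
        fix x y assume "(x, y) \<in> ?R"
        then show "(x, y) \<in> carrier S \<times> carrier S"
          using R_cases[of x y] \<theta>D(1,2) \<phi>D(1,2) i_in_S j_in_S by (metis mem_Sigma_iff)
      qed
      show "refl_on (carrier S) ?R"
        using glued_refl[OF \<theta> \<phi>] by (rule refl_onI)
      show "sym ?R"
      proof (rule symI)
        fix x y assume "(x, y) \<in> ?R"
        then show "(y, x) \<in> ?R"
          using R_cases[of x y] \<theta>D(2,4) \<phi>D(2,4) glued_i_iff[OF \<theta> \<phi>] glued_j_iff[OF \<theta> \<phi>] by metis
      qed
      show "trans ?R"
      proof (rule transI)
        fix x y z assume xy: "(x, y) \<in> ?R" and yz: "(y, z) \<in> ?R"
        from R_cases[OF xy] show "(x, z) \<in> ?R"
        proof (elim disjE exE conjE)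
          fix a a' assume a: "x = i a" "y = i a'" "(a, a') \<in> \<theta>"
          then show ?thesis
            using yz \<theta>D(5)[OF a(3)] glued_i_iff[OF \<theta> \<phi> \<theta>D(1)[OF a(3)]]
              glued_i_iff[OF \<theta> \<phi> \<theta>D(2)[OF a(3)]] by blast
        next
          fix b b' assume b: "x = j b" "y = j b'" "(b, b') \<in> \<phi>"
          then show ?thesis
            using yz \<phi>D(5)[OF b(3)] glued_j_iff[OF \<theta> \<phi> \<phi>D(1)[OF b(3)]]
              glued_j_iff[OF \<theta> \<phi> \<phi>D(2)[OF b(3)]] by blast
        qed
      qed
    qed
    fix x x' y assume "(x, x') \<in> ?R" and y: "y \<in> carrier S"
    then show "(x \<squnion>\<^bsub>S\<^esub> y, x' \<squnion>\<^bsub>S\<^esub> y) \<in> ?R \<and> (x \<sqinter>\<^bsub>S\<^esub> y, x' \<sqinter>\<^bsub>S\<^esub> y) \<in> ?R"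
      using R_cases[of x x'] glued_join[OF \<theta> \<phi> _ y] glued_meet[OF \<theta> \<phi> _ y]
        horizontal_sum.glued_join[OF swap \<phi> \<theta> _ y] horizontal_sum.glued_meet[OF swap \<phi> \<theta> _ y]
      unfolding glued_swap[of j i] by blast
  qed
  moreover have "?R `` {\<bottom>\<^bsub>S\<^esub>} = {\<bottom>\<^bsub>S\<^esub>}"
    using glued_i_iff[OF \<theta> \<phi> A.bottom_closed] congruences01D(2)[OF \<theta>] \<theta>D(3)[OF A.bottom_closed]
    unfolding bot_S by blast
  moreover have "?R `` {\<top>\<^bsub>S\<^esub>} = {\<top>\<^bsub>S\<^esub>}"
    using glued_i_iff[OF \<theta> \<phi> A.top_closed] congruences01D(3)[OF \<theta>] \<theta>D(3)[OF A.top_closed]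
    unfolding top_S by blast
  ultimately show ?thesis by (simp add: congruences01_def)
qed

lemma pullback_congruence:
  assumes \<psi>: "\<psi> \<in> congruences01 S"
  shows "pullback i (carrier A) \<psi> \<in> congruences01 A" (is "?\<theta> \<in> _")
proof -
  note D = congruencesD[OF congruences01D(1)[OF \<psi>]]
  have mem: "(a, a') \<in> ?\<theta> \<longleftrightarrow> a \<in> carrier A \<and> a' \<in> carrier A \<and> (i a, i a') \<in> \<psi>" for a a'
    by (simp add: pullback_def)
  have "?\<theta> \<in> congruences A"
  proof (rule congruencesI[OF A.lattice_axioms])
    show "equiv (carrier A) ?\<theta>"
    proof (rule equivI)
      show "?\<theta> \<subseteq> carrier A \<times> carrier A" by (auto simp: mem)
      show "refl_on (carrier A) ?\<theta>" using D(3)[OF i_in_S] by (simp add: refl_on_def mem)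
      show "sym ?\<theta>" using D(4) by (simp add: sym_def mem)
      show "trans ?\<theta>" unfolding trans_def mem using D(5) by blast
    qed
    fix a a' c assume "(a, a') \<in> ?\<theta>" "c \<in> carrier A"
    then show "(a \<squnion>\<^bsub>A\<^esub> c, a' \<squnion>\<^bsub>A\<^esub> c) \<in> ?\<theta> \<and> (a \<sqinter>\<^bsub>A\<^esub> c, a' \<sqinter>\<^bsub>A\<^esub> c) \<in> ?\<theta>"
      using D(6)[OF _ D(3)[OF i_in_S], of "i a" "i a'" c] D(7)[OF _ D(3)[OF i_in_S], of "i a" "i a'" c]
      by (simp add: mem join_ii meet_ii)
  qed
  moreover have "?\<theta> `` {\<bottom>\<^bsub>A\<^esub>} = {\<bottom>\<^bsub>A\<^esub>}" "?\<theta> `` {\<top>\<^bsub>A\<^esub>} = {\<top>\<^bsub>A\<^esub>}"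
    using congruences01D(2,3)[OF \<psi>] D(3)[OF i_in_S[OF A.bottom_closed]]
      D(3)[OF i_in_S[OF A.top_closed]] i_eq_iff[OF _ A.bottom_closed] i_eq_iff[OF _ A.top_closed]
    unfolding bot_S top_S Image_singleton mem by blast+
  ultimately show ?thesis by (simp add: congruences01_def)
qed

text \<open>
  Surjectivity of gluing: a congruence with trivial classes of the bounds does not relate proper
  elements of different summands, so its restrictions to the summands determine it.
\<close>

lemma glued_pullback:
  assumes \<psi>: "\<psi> \<in> congruences01 S"
  shows "glued i j (pullback i (carrier A) \<psi>) (pullback j (carrier B) \<psi>) = \<psi>"
proof (intro equalityI subrelI)
  fix x y assume xy: "(x, y) \<in> \<psi>"
  have "x \<in> carrier S" using congruencesD(1)[OF congruences01D(1)[OF \<psi>] xy] .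
  then consider (A) a a' where "a \<in> carrier A" "a' \<in> carrier A" "x = i a" "y = i a'"
    | (B) b b' where "b \<in> carrier B" "b' \<in> carrier B" "x = j b" "y = j b'"
    using U.congruence01_same_side[OF \<psi> xy] carrier_S by blast
  then show "(x, y) \<in> glued i j (pullback i (carrier A) \<psi>) (pullback j (carrier B) \<psi>)"
    using xy unfolding glued_def pullback_def by cases (auto simp: image_iff)
qed (auto simp: glued_def pullback_def)

lemma glued_bij:
  "bij_betw (\<lambda>(\<theta>, \<phi>). glued i j \<theta> \<phi>) (congruences01 A \<times> congruences01 B) (congruences01 S)"
proof (rule bij_betw_imageI)
  show "inj_on (\<lambda>(\<theta>, \<phi>). glued i j \<theta> \<phi>) (congruences01 A \<times> congruences01 B)"
  proof (rule inj_onI, clarify)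
    fix \<theta> \<theta>' \<phi> \<phi>'
    assume "\<theta> \<in> congruences01 A" "\<phi> \<in> congruences01 B" "\<theta>' \<in> congruences01 A" "\<phi>' \<in> congruences01 B"
      and "glued i j \<theta> \<phi> = glued i j \<theta>' \<phi>'"
    then show "\<theta> = \<theta>' \<and> \<phi> = \<phi>'"
      using glued_le_iff[of \<theta> \<theta>' \<phi> \<phi>'] glued_le_iff[of \<theta>' \<theta> \<phi>' \<phi>] by blast
  qed
  show "(\<lambda>(\<theta>, \<phi>). glued i j \<theta> \<phi>) ` (congruences01 A \<times> congruences01 B) = congruences01 S"
  proof (intro equalityI subsetI)
    fix \<psi> assume \<psi>: "\<psi> \<in> congruences01 S"
    then have "(pullback i (carrier A) \<psi>, pullback j (carrier B) \<psi>) \<in> congruences01 A \<times> congruences01 B"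
      using pullback_congruence horizontal_sum.pullback_congruence[OF swap] by blast
    then show "\<psi> \<in> (\<lambda>(\<theta>, \<phi>). glued i j \<theta> \<phi>) ` (congruences01 A \<times> congruences01 B)"
      by (rule rev_image_eqI) (simp add: glued_pullback[OF \<psi>])
  next
    fix \<psi> assume "\<psi> \<in> (\<lambda>(\<theta>, \<phi>). glued i j \<theta> \<phi>) ` (congruences01 A \<times> congruences01 B)"
    then obtain \<theta> \<phi> where "\<theta> \<in> congruences01 A" "\<phi> \<in> congruences01 B" "\<psi> = glued i j \<theta> \<phi>"
      by blast
    then show "\<psi> \<in> congruences01 S" using glued_congruence by simp
  qed
qed

end

section \<open>The congruence lattice as an ordinal sum\<close>

lemma congruences01_downward:
  assumes \<theta>: "\<theta> \<in> congruences01 L" and \<psi>: "\<psi> \<in> congruences L" and le: "\<psi> \<subseteq> \<theta>"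
    and bounds: "\<bottom>\<^bsub>L\<^esub> \<in> carrier L" "\<top>\<^bsub>L\<^esub> \<in> carrier L"
  shows "\<psi> \<in> congruences01 L"
proof -
  have "\<theta> `` {\<bottom>\<^bsub>L\<^esub>} = {\<bottom>\<^bsub>L\<^esub>}" "\<theta> `` {\<top>\<^bsub>L\<^esub>} = {\<top>\<^bsub>L\<^esub>}"
    using \<theta> by (simp_all add: congruences01_def)
  then have "\<psi> `` {\<bottom>\<^bsub>L\<^esub>} = {\<bottom>\<^bsub>L\<^esub>}" "\<psi> `` {\<top>\<^bsub>L\<^esub>} = {\<top>\<^bsub>L\<^esub>}"
    using le congruencesD(3)[OF \<psi> bounds(1)] congruencesD(3)[OF \<psi> bounds(2)] by blast+
  then show ?thesis using \<psi> by (simp add: congruences01_def)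
qed

text \<open>
  The congruences of \<open>S\<close> fall into a lower part with trivial classes of the bounds, which is a product,
  and an upper part, for which \<open>T\<close> without its bottom is a model by way of \<open>h\<close>. Every lower
  congruence lies below every upper one, and no upper one lies below a lower one.
\<close>

lemma (in horizontal_sum) Con_iso_ordinal_sum:
  fixes T :: "'t gorder" and h :: "'t \<Rightarrow> 'c rel"
  assumes h: "bij_betw h (carrier T - {\<bottom>\<^bsub>T\<^esub>}) (congruences S - congruences01 S)"
    and ord: "\<And>s t. s \<in> carrier T - {\<bottom>\<^bsub>T\<^esub>} \<Longrightarrow> t \<in> carrier T - {\<bottom>\<^bsub>T\<^esub>} \<Longrightarrow>
      h s \<subseteq> h t \<longleftrightarrow> s \<sqsubseteq>\<^bsub>T\<^esub> t"
  shows "Con S \<cong>\<^sub>l ordinal_sum (prod_lattice (Con01 A) (Con01 B)) T"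
    (is "_ \<cong>\<^sub>l ?M")
proof (rule lattice_iso_of_order_iso)
  let ?g = "\<lambda>(\<theta>, \<phi>). glued i j \<theta> \<phi>"
  let ?f = "case_sum ?g h"
  let ?P = "congruences01 A \<times> congruences01 B" and ?Q = "carrier T - {\<bottom>\<^bsub>T\<^esub>}"
  have carM: "carrier ?M = Inl ` ?P \<union> Inr ` ?Q"
    by (simp add: ordinal_sum_def prod_lattice_def Con01_def)
  show "lattice (Con S)" by (rule Con_lattice[OF lattice_S])
  show "eq ?M = (=)" by (simp add: ordinal_sum_def)
  have "bij_betw ?f (Inl ` ?P) (congruences01 S)"
    using glued_bij unfolding bij_betw_def by (simp add: inj_on_def image_image)
  moreover have "bij_betw ?f (Inr ` ?Q) (congruences S - congruences01 S)"
    using h unfolding bij_betw_def by (simp add: inj_on_def image_image)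
  ultimately have "bij_betw ?f (Inl ` ?P \<union> Inr ` ?Q) (congruences01 S \<union> (congruences S - congruences01 S))"
    by (rule bij_betw_combine) blast
  moreover have "congruences01 S \<union> (congruences S - congruences01 S) = congruences S"
    using congruences01D(1) by blast
  ultimately show "bij_betw ?f (carrier ?M) (carrier (Con S))"
    by (simp add: carM Con_def)
  have h_big: "h t \<in> congruences S - congruences01 S" if "t \<in> ?Q" for t
    using h that by (rule bij_betw_apply)
  fix u v assume "u \<in> carrier ?M" "v \<in> carrier ?M"
  then consider
    (LL) \<theta> \<phi> \<theta>' \<phi>' where "\<theta> \<in> congruences01 A" "\<phi> \<in> congruences01 B" "u = Inl (\<theta>, \<phi>)"
      "\<theta>' \<in> congruences01 A" "\<phi>' \<in> congruences01 B" "v = Inl (\<theta>', \<phi>')"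
    | (LR) \<theta> \<phi> t where "\<theta> \<in> congruences01 A" "\<phi> \<in> congruences01 B" "u = Inl (\<theta>, \<phi>)"
      "t \<in> ?Q" "v = Inr t"
    | (RL) \<theta> \<phi> t where "\<theta> \<in> congruences01 A" "\<phi> \<in> congruences01 B" "v = Inl (\<theta>, \<phi>)"
      "t \<in> ?Q" "u = Inr t"
    | (RR) s t where "s \<in> ?Q" "u = Inr s" "t \<in> ?Q" "v = Inr t"
    unfolding carM by blast
  then show "?f u \<sqsubseteq>\<^bsub>Con S\<^esub> ?f v \<longleftrightarrow> u \<sqsubseteq>\<^bsub>?M\<^esub> v"
  proof cases
    case LL
    then show ?thesis
      using glued_le_iff[OF LL(1,4,2,5)]
      by (simp add: Con_def Con01_def ordinal_sum_def prod_lattice_def)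
  next
    case LR
    have "glued i j \<theta> \<phi> \<subseteq> h t"
      by (rule U.congruence01_le_big[OF glued_congruence[OF LR(1,2)] h_big[OF LR(4)]])
    then show ?thesis using LR by (simp add: Con_def ordinal_sum_def)
  next
    case RL
    have "\<not> h t \<subseteq> glued i j \<theta> \<phi>"
      using congruences01_downward[OF glued_congruence[OF RL(1,2)] _ _ S.bottom_closed S.top_closed]
        h_big[OF RL(4)] by blast
    then show ?thesis using RL by (simp add: Con_def ordinal_sum_def)
  next
    case RR
    then show ?thesis using ord[OF RR(1,3)] by (simp add: Con_def ordinal_sum_def)
  qed
qed

lemma bottom_eqI:
  assumes "b \<in> carrier L" "\<And>x. x \<in> carrier L \<Longrightarrow> b \<sqsubseteq>\<^bsub>L\<^esub> x"
    and "\<And>x. x \<in> carrier L \<Longrightarrow> x \<sqsubseteq>\<^bsub>L\<^esub> b \<Longrightarrow> x = b"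
  shows "\<bottom>\<^bsub>L\<^esub> = b"
  unfolding bottom_def
  by (rule some_equality) (use assms in \<open>auto simp: least_def\<close>)

lemma chain_lattice_bottom: "0 < n \<Longrightarrow> \<bottom>\<^bsub>chain_lattice n\<^esub> = 0"
  by (rule bottom_eqI) (auto simp: chain_lattice_def)

lemma square_bottom: "\<bottom>\<^bsub>prod_lattice (chain_lattice 2) (chain_lattice 2)\<^esub> = (0, 0)"
  by (rule bottom_eqI) (auto simp: prod_lattice_def chain_lattice_def)

text \<open>
  Two-block partitions are comparable only if they are equal, provided that the elements \<open>t\<close> and \<open>b\<close> fix
  which block is which.
\<close>

lemma eq_of_le_iff:
  assumes "F \<subseteq> C" "F' \<subseteq> C" and t: "t \<in> F" "t \<in> F'" and b: "b \<in> C - F" "b \<in> C - F'"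
  shows "eq_of {F, C - F} \<subseteq> eq_of {F', C - F'} \<longleftrightarrow> F = F'"
proof
  assume le: "eq_of {F, C - F} \<subseteq> eq_of {F', C - F'}"
  have "x \<in> F'" if "x \<in> F" for x
  proof -
    have "(x, t) \<in> eq_of {F, C - F}" using that t by (simp add: eq_of_def)
    then have "(x, t) \<in> eq_of {F', C - F'}" using le by blast
    then show ?thesis using t(2) by (auto simp: eq_of_def)
  qed
  moreover have "x \<in> F" if "x \<in> F'" for x
  proof (rule ccontr)
    assume "x \<notin> F"
    then have "(x, b) \<in> eq_of {F, C - F}" using that b assms(2) by (auto simp: eq_of_def)
    then have "(x, b) \<in> eq_of {F', C - F'}" using le by blast
    then show False using that b(2) by (auto simp: eq_of_def)
  qed
  ultimately show "F = F'" by blast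
qed simp

lemma subset_pair:
  assumes "C \<subseteq> {a, b}" "a \<noteq> b"
  shows "C = {} \<longleftrightarrow> a \<notin> C \<and> b \<notin> C"
    "C = {a} \<longleftrightarrow> a \<in> C \<and> b \<notin> C"
    "C = {b} \<longleftrightarrow> b \<in> C \<and> a \<notin> C"
    "C = {a, b} \<longleftrightarrow> a \<in> C \<and> b \<in> C"
    "card C = 2 \<longleftrightarrow> C = {a, b}"
proof -
  have "C = {} \<or> C = {a} \<or> C = {b} \<or> C = {a, b}" using assms(1) by blast
  then show "C = {} \<longleftrightarrow> a \<notin> C \<and> b \<notin> C"
    "C = {a} \<longleftrightarrow> a \<in> C \<and> b \<notin> C"
    "C = {b} \<longleftrightarrow> b \<in> C \<and> a \<notin> C"
    "C = {a, b} \<longleftrightarrow> a \<in> C \<and> b \<in> C"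
    "card C = 2 \<longleftrightarrow> C = {a, b}"
    using assms(2) by (elim disjE; auto)+
qed

context horizontal_sum
begin

abbreviation split_congruence :: "'c set \<Rightarrow> 'c rel" where
  "split_congruence F \<equiv> eq_of {F, carrier S - F}"

lemma split_le_iff:
  assumes "F \<in> SpecFilt S" "F' \<in> SpecFilt S"
  shows "split_congruence F \<subseteq> split_congruence F' \<longleftrightarrow> F = F'"
  using SpecFilt_bounds[OF bounded_lattice_S assms(1)] SpecFilt_bounds[OF bounded_lattice_S assms(2)]
  by (intro eq_of_le_iff[of _ _ _ "\<top>\<^bsub>S\<^esub>" "\<bottom>\<^bsub>S\<^esub>"]) simp_all

lemma split_less_nabla:
  assumes F: "F \<in> SpecFilt S"
  shows "split_congruence F \<subseteq> nabla S" "\<not> nabla S \<subseteq> split_congruence F"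
proof -
  note b = SpecFilt_bounds[OF bounded_lattice_S F]
  show "split_congruence F \<subseteq> nabla S" using b(1) by (auto simp: eq_of_def nabla_def)
  have "(\<bottom>\<^bsub>S\<^esub>, \<top>\<^bsub>S\<^esub>) \<notin> split_congruence F" using b(2,3) by (simp add: eq_of_def)
  moreover have "(\<bottom>\<^bsub>S\<^esub>, \<top>\<^bsub>S\<^esub>) \<in> nabla S" by (simp add: nabla_def)
  ultimately show "\<not> nabla S \<subseteq> split_congruence F" by blast
qed

lemma Con_iso_no_filter:
  assumes "SpecFilt S = {}"
  shows "Con S \<cong>\<^sub>l ordinal_sum (prod_lattice (Con01 A) (Con01 B)) (chain_lattice 2)"
proof (rule Con_iso_ordinal_sum)
  have car: "carrier (chain_lattice 2) - {\<bottom>\<^bsub>chain_lattice 2\<^esub>} = {1}"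
    by (auto simp: chain_lattice_bottom) (auto simp: chain_lattice_def)
  show "bij_betw (\<lambda>_. nabla S) (carrier (chain_lattice 2) - {\<bottom>\<^bsub>chain_lattice 2\<^esub>})
      (congruences S - congruences01 S)"
    unfolding car U.big_congruences assms by (simp add: bij_betw_def)
  show "nabla S \<subseteq> nabla S \<longleftrightarrow> s \<sqsubseteq>\<^bsub>chain_lattice 2\<^esub> t"
    if "s \<in> carrier (chain_lattice 2) - {\<bottom>\<^bsub>chain_lattice 2\<^esub>}"
      "t \<in> carrier (chain_lattice 2) - {\<bottom>\<^bsub>chain_lattice 2\<^esub>}" for s t
    using that unfolding car by (simp add: chain_lattice_def)
qed

lemma Con_iso_one_filter:
  assumes F: "SpecFilt S = {F}"
  shows "Con S \<cong>\<^sub>l ordinal_sum (prod_lattice (Con01 A) (Con01 B)) (chain_lattice 3)"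
proof (rule Con_iso_ordinal_sum)
  let ?h = "\<lambda>n::nat. if n = 1 then split_congruence F else nabla S"
  have car: "carrier (chain_lattice 3) - {\<bottom>\<^bsub>chain_lattice 3\<^esub>} = {1, 2}"
    by (auto simp: chain_lattice_bottom) (auto simp: chain_lattice_def)
  have lt: "split_congruence F \<subseteq> nabla S" "\<not> nabla S \<subseteq> split_congruence F"
    using split_less_nabla[of F] F by simp_all
  then have neq: "split_congruence F \<noteq> nabla S" by blast
  show "bij_betw ?h (carrier (chain_lattice 3) - {\<bottom>\<^bsub>chain_lattice 3\<^esub>})
      (congruences S - congruences01 S)"
    unfolding car U.big_congruences F
    using neq by (simp add: bij_betw_def inj_on_def insert_commute)
  show "?h s \<subseteq> ?h t \<longleftrightarrow> s \<sqsubseteq>\<^bsub>chain_lattice 3\<^esub> t"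
    if "s \<in> carrier (chain_lattice 3) - {\<bottom>\<^bsub>chain_lattice 3\<^esub>}"
      "t \<in> carrier (chain_lattice 3) - {\<bottom>\<^bsub>chain_lattice 3\<^esub>}" for s t
    using that lt unfolding car by (elim insertE emptyE) (simp_all add: chain_lattice_def)
qed

lemma Con_iso_two_filters:
  assumes F: "SpecFilt S = {F, F'}" "F \<noteq> F'"
  shows "Con S \<cong>\<^sub>l ordinal_sum (prod_lattice (Con01 A) (Con01 B))
    (prod_lattice (chain_lattice 2) (chain_lattice 2))" (is "_ \<cong>\<^sub>l ordinal_sum _ ?T")
proof (rule Con_iso_ordinal_sum)
  let ?h = "\<lambda>p::nat \<times> nat. if p = (0, 1) then split_congruence F
    else if p = (1, 0) then split_congruence F' else nabla S"
  have car: "carrier ?T - {\<bottom>\<^bsub>?T\<^esub>} = {(0, 1), (1, 0), (1, 1)}"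
    by (auto simp: square_bottom) (auto simp: prod_lattice_def chain_lattice_def)
  have lt: "split_congruence F \<subseteq> nabla S" "\<not> nabla S \<subseteq> split_congruence F"
    "split_congruence F' \<subseteq> nabla S" "\<not> nabla S \<subseteq> split_congruence F'"
    "\<not> split_congruence F \<subseteq> split_congruence F'" "\<not> split_congruence F' \<subseteq> split_congruence F"
    using split_less_nabla[of F] split_less_nabla[of F'] split_le_iff[of F F']
      split_le_iff[of F' F] F by simp_all
  then have neq: "split_congruence F \<noteq> nabla S" "split_congruence F' \<noteq> nabla S"
    "split_congruence F \<noteq> split_congruence F'" by blast+
  show "bij_betw ?h (carrier ?T - {\<bottom>\<^bsub>?T\<^esub>}) (congruences S - congruences01 S)"
    unfolding car U.big_congruences F(1)
    using neq by (simp add: bij_betw_def inj_on_def insert_commute)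
  show "?h s \<subseteq> ?h t \<longleftrightarrow> s \<sqsubseteq>\<^bsub>?T\<^esub> t"
    if "s \<in> carrier ?T - {\<bottom>\<^bsub>?T\<^esub>}" "t \<in> carrier ?T - {\<bottom>\<^bsub>?T\<^esub>}" for s t
    using that lt unfolding car
    by (elim insertE emptyE) (simp_all add: prod_lattice_def chain_lattice_def)
qed

abbreviation filter_A :: "'c set" where
  "filter_A \<equiv> i ` carrier A - {\<bottom>\<^bsub>S\<^esub>}"

abbreviation filter_B :: "'c set" where
  "filter_B \<equiv> j ` carrier B - {\<bottom>\<^bsub>S\<^esub>}"

lemma filter_A_neq_B: "filter_A \<noteq> filter_B"
  using U.proper_X U.inter_eq by blast

lemma SpecFilt_sub: "SpecFilt S \<subseteq> {filter_A, filter_B}"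
  using U.SpecFilt_cases by blast

text \<open>
  The two sets are treated here without knowing that they are filters: the equations to be refuted
  mention them also in the case that they are not prime.
\<close>

lemma candidate_props:
  assumes "F \<in> {filter_A, filter_B}"
  shows "F \<subseteq> carrier S" "split_congruence F `` {\<top>\<^bsub>S\<^esub>} = F" "split_congruence F \<noteq> nabla S"
    "split_congruence F \<notin> congruences01 S"
proof -
  show sub: "F \<subseteq> carrier S" using assms U.X_sub U.Y_sub by blast
  have top: "\<top>\<^bsub>S\<^esub> \<in> F" using assms U.bounds_X U.bounds_Y U.bounds_distinct by auto
  show block: "split_congruence F `` {\<top>\<^bsub>S\<^esub>} = F"
    by (rule eq_of_block[OF sub top])
  have "F - {\<top>\<^bsub>S\<^esub>} \<noteq> {}" using assms U.proper_X U.proper_Y by blast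
  then show "split_congruence F \<notin> congruences01 S"
    using block by (auto simp: congruences01_def)
  have "\<bottom>\<^bsub>S\<^esub> \<in> nabla S `` {\<top>\<^bsub>S\<^esub>}" by (simp add: nabla_def)
  moreover have "\<bottom>\<^bsub>S\<^esub> \<notin> F" using assms by auto
  ultimately show "split_congruence F \<noteq> nabla S" using block by metis
qed

lemma split_image_eq_iff:
  assumes "\<F> \<subseteq> {filter_A, filter_B}"
  shows "split_congruence ` SpecFilt S = split_congruence ` \<F> \<longleftrightarrow> SpecFilt S = \<F>"
proof (rule inj_on_image_eq_iff[OF _ SpecFilt_sub assms])
  show "inj_on split_congruence {filter_A, filter_B}"
    by (rule inj_onI) (metis candidate_props(2))
qed

lemma two_class_eq_iff:
  assumes "\<F> \<subseteq> {filter_A, filter_B}"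
  shows "two_class_congruences S = split_congruence ` \<F> \<longleftrightarrow> SpecFilt S = \<F>"
  unfolding two_class_congruences_eq[OF bounded_lattice_S] by (rule split_image_eq_iff[OF assms])

lemma two_class_card_iff:
  "card (two_class_congruences S) = 2 \<longleftrightarrow> SpecFilt S = {filter_A, filter_B}"
proof -
  have inj: "inj_on split_congruence {filter_A, filter_B}"
    by (rule inj_onI) (metis candidate_props(2))
  then have "card (two_class_congruences S) = card (SpecFilt S)"
    unfolding two_class_congruences_eq[OF bounded_lattice_S]
    using card_image[OF inj_on_subset[OF inj SpecFilt_sub]] by simp
  moreover have "card (SpecFilt S) = 2 \<longleftrightarrow> SpecFilt S = {filter_A, filter_B}"
    by (rule subset_pair(5)[OF SpecFilt_sub filter_A_neq_B])
  ultimately show ?thesis by simp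
qed

lemma SpecId_eq_iff:
  assumes "\<F> \<subseteq> {filter_A, filter_B}"
  shows "SpecId S = (\<lambda>F. carrier S - F) ` \<F> \<longleftrightarrow> SpecFilt S = \<F>"
  unfolding SpecId_eq[OF bounded_lattice_S]
proof (rule inj_on_image_eq_iff[OF _ SpecFilt_sub assms])
  show "inj_on (\<lambda>F. carrier S - F) {filter_A, filter_B}"
    using candidate_props(1) by (intro inj_onI) (metis double_diff subset_refl)
qed

text \<open>
  The two unions are disjoint, so an equation between them compares the upper parts, and \<open>\<nabla>\<close>, which is
  not of the form \<open>split_congruence F\<close>, cancels.
\<close>

lemma Con_eq_iff:
  assumes \<F>: "\<F> \<subseteq> {filter_A, filter_B}"
  shows "congruences S = congruences01 S \<union> insert (nabla S) (split_congruence ` \<F>) \<longleftrightarrow>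
    SpecFilt S = \<F>"
proof -
  have disjoint: "\<psi> \<notin> congruences01 S" if "\<psi> \<in> insert (nabla S) (split_congruence ` \<F>)" for \<psi>
  proof -
    have "nabla S \<notin> congruences01 S" using U.big_congruences by blast
    then show ?thesis using that candidate_props(4)[OF subsetD[OF \<F>]] by blast
  qed
  have nabla: "nabla S \<notin> split_congruence ` \<G>" if "\<G> \<subseteq> {filter_A, filter_B}" for \<G>
  proof
    assume "nabla S \<in> split_congruence ` \<G>"
    then obtain F where "nabla S = split_congruence F" "F \<in> \<G>" by (rule imageE)
    then show False using candidate_props(3)[OF subsetD[OF that]] by metis
  qed
  have sub: "congruences01 S \<subseteq> congruences S" by (rule subsetI) (rule congruences01D(1))
  have "congruences S = congruences01 S \<union> insert (nabla S) (split_congruence ` \<F>) \<longleftrightarrow>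
      congruences S - congruences01 S = insert (nabla S) (split_congruence ` \<F>)"
    using disjoint sub by blast
  also have "\<dots> \<longleftrightarrow> split_congruence ` SpecFilt S = split_congruence ` \<F>"
    unfolding U.big_congruences by (rule insert_ident[OF nabla[OF SpecFilt_sub] nabla[OF \<F>]])
  finally show ?thesis unfolding split_image_eq_iff[OF \<F>] .
qed

end

section \<open>The horizontal sum of two bounded lattices\<close>

text \<open>
  The cardinality condition covers infinite carriers, whose \<open>card\<close> is \<open>0\<close>.
\<close>

lemma proper_element:
  assumes L: "bounded_lattice L" and card: "finite (carrier L) \<longrightarrow> card (carrier L) > 2"
  shows "\<exists>a\<in>carrier L. a \<noteq> \<bottom>\<^bsub>L\<^esub> \<and> a \<noteq> \<top>\<^bsub>L\<^esub>"
proof (rule ccontr)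
  assume "\<not> ?thesis"
  then have sub: "carrier L \<subseteq> {\<bottom>\<^bsub>L\<^esub>, \<top>\<^bsub>L\<^esub>}" by blast
  then have "finite (carrier L)" by (rule finite_subset) simp
  moreover have "card (carrier L) \<le> 2"
    using card_mono[OF _ sub] by (rule order_trans) (simp_all add: card_insert_if)
  ultimately show False using card by simp
qed

lemma horizontal_sum_hsum:
  assumes A: "bounded_lattice A" "finite (carrier A) \<longrightarrow> card (carrier A) > 2"
    and B: "bounded_lattice B" "finite (carrier B) \<longrightarrow> card (carrier B) > 2"
  shows "horizontal_sum A B (A \<boxplus> B) (hsum_inA A B) (hsum_inB A B)"
proof -
  interpret A: bounded_lattice A by fact
  interpret B: bounded_lattice B by fact
  have neqs: "\<bottom>\<^bsub>A\<^esub> \<noteq> \<top>\<^bsub>A\<^esub>" "\<bottom>\<^bsub>B\<^esub> \<noteq> \<top>\<^bsub>B\<^esub>"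
    using proper_element[OF A] proper_element[OF B] A.bot_neq_top B.bot_neq_top by blast+
  show ?thesis
  proof (intro horizontal_sum.intro horizontal_sum_axioms.intro)
    show "inj_on (hsum_inB A B) (carrier B)"
      using neqs by (auto simp: inj_on_def hsum_inB_def split: if_splits)
    show "hsum_inA A B a = hsum_inB A B b \<longleftrightarrow>
        a = \<bottom>\<^bsub>A\<^esub> \<and> b = \<bottom>\<^bsub>B\<^esub> \<or> a = \<top>\<^bsub>A\<^esub> \<and> b = \<top>\<^bsub>B\<^esub>" for a b
      using neqs by (auto simp: hsum_inA_def hsum_inB_def)
  qed (use A B proper_element[OF A] proper_element[OF B] in
      \<open>simp_all add: hsum_def hsum_A_def hsum_B_def inj_on_def hsum_inA_def\<close>)
qed

lemma all_equivalent5I: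
  assumes "P1 \<longleftrightarrow> Q" "P2 \<longleftrightarrow> Q" "P3 \<longleftrightarrow> Q" "P4 \<longleftrightarrow> Q" "P5 \<longleftrightarrow> Q"
  shows "all_equivalent [P1, P2, P3, P4, P5]"
  using assms by (simp add: all_equivalent_def)

theorem theorem4p7:
  fixes A :: "'a gorder" and B :: "'b gorder"
  assumes "bounded_lattice A" and "bounded_lattice B"
    and "finite (carrier A) \<longrightarrow> card (carrier A) > 2"
    and "finite (carrier B) \<longrightarrow> card (carrier B) > 2"
  shows
    "let S = A \<boxplus> B;
         A' = hsum_A A B; B' = hsum_B A B;
         z = \<bottom>\<^bsub>S\<^esub>; e = \<top>\<^bsub>S\<^esub>;
         \<alpha> = eq_of {A' - {z}, B' - {e}};
         \<beta> = eq_of {A' - {e}, B' - {z}};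
         K = prod_lattice (Con01 A) (Con01 B)
     in
       all_equivalent
         [carrier (Con S) = carrier (Con01 S) \<union> {nabla S} \<and>
            Con S \<cong>\<^sub>l ordinal_sum K (chain_lattice 2),
          two_class_congruences S = {},
          SpecFilt S = {},
          SpecId S = {},
          (bot_meet_reducible A \<or> top_join_reducible B) \<and>
          (bot_meet_reducible B \<or> top_join_reducible A)]
       \<and>
       all_equivalent
         [carrier (Con S) = carrier (Con01 S) \<union> {\<alpha>, nabla S} \<and>
            Con S \<cong>\<^sub>l ordinal_sum K (chain_lattice 3),
          two_class_congruences S = {\<alpha>},
          SpecFilt S = {A' - {z}},
          SpecId S = {B' - {e}},
          bot_meet_irreducible A \<and> top_join_irreducible B \<and>
          (bot_meet_reducible B \<or> top_join_reducible A)]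
       \<and>
       all_equivalent
         [carrier (Con S) = carrier (Con01 S) \<union> {\<beta>, nabla S} \<and>
            Con S \<cong>\<^sub>l ordinal_sum K (chain_lattice 3),
          two_class_congruences S = {\<beta>},
          SpecFilt S = {B' - {z}},
          SpecId S = {A' - {e}},
          bot_meet_irreducible B \<and> top_join_irreducible A \<and>
          (bot_meet_reducible A \<or> top_join_reducible B)]
       \<and>
       all_equivalent
         [carrier (Con S) = carrier (Con01 S) \<union> {\<alpha>, \<beta>, nabla S} \<and>
            Con S \<cong>\<^sub>l ordinal_sum K (prod_lattice (chain_lattice 2) (chain_lattice 2)),
          card (two_class_congruences S) = 2,
          SpecFilt S = {A' - {z}, B' - {z}},
          SpecId S = {A' - {e}, B' - {e}},
          bot_meet_irreducible A \<and> bot_meet_irreducible B \<and>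
          top_join_irreducible A \<and> top_join_irreducible B]"
proof -
  interpret H: horizontal_sum A B "A \<boxplus> B" "hsum_inA A B" "hsum_inB A B"
    by (rule horizontal_sum_hsum[OF assms(1,3,2,4)])
  let ?S = "A \<boxplus> B" and ?FA = "H.filter_A" and ?FB = "H.filter_B"
  let ?K = "prod_lattice (Con01 A) (Con01 B)"
  have complements: "carrier ?S - ?FA = hsum_B A B - {\<top>\<^bsub>?S\<^esub>}" "carrier ?S - ?FB = hsum_A A B - {\<top>\<^bsub>?S\<^esub>}"
    using H.U.complement_bot H.U.complement_bot_Y by (simp_all add: hsum_A_def hsum_B_def)
  have alpha: "eq_of {hsum_A A B - {\<bottom>\<^bsub>?S\<^esub>}, hsum_B A B - {\<top>\<^bsub>?S\<^esub>}} = H.split_congruence ?FA"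
    by (simp add: complements hsum_A_def)
  have beta: "eq_of {hsum_A A B - {\<top>\<^bsub>?S\<^esub>}, hsum_B A B - {\<bottom>\<^bsub>?S\<^esub>}} = H.split_congruence ?FB"
    by (simp add: complements hsum_B_def insert_commute)
  have filters: "hsum_A A B - {\<bottom>\<^bsub>?S\<^esub>} = ?FA" "hsum_B A B - {\<bottom>\<^bsub>?S\<^esub>} = ?FB"
    by (simp_all add: hsum_A_def hsum_B_def)
  have cars: "carrier (Con ?S) = congruences ?S" "carrier (Con01 ?S) = congruences01 ?S"
    by (simp_all add: Con_def Con01_def)
  have FA: "?FA \<in> SpecFilt ?S \<longleftrightarrow> bot_meet_irreducible A \<and> top_join_irreducible B"
    and FB: "?FB \<in> SpecFilt ?S \<longleftrightarrow> bot_meet_irreducible B \<and> top_join_irreducible A"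
    by (rule H.SpecFilt_i_iff, rule H.SpecFilt_j_iff)
  have Spec: "SpecFilt ?S = {} \<longleftrightarrow> ?FA \<notin> SpecFilt ?S \<and> ?FB \<notin> SpecFilt ?S"
    "SpecFilt ?S = {?FA} \<longleftrightarrow> ?FA \<in> SpecFilt ?S \<and> ?FB \<notin> SpecFilt ?S"
    "SpecFilt ?S = {?FB} \<longleftrightarrow> ?FB \<in> SpecFilt ?S \<and> ?FA \<notin> SpecFilt ?S"
    "SpecFilt ?S = {?FA, ?FB} \<longleftrightarrow> ?FA \<in> SpecFilt ?S \<and> ?FB \<in> SpecFilt ?S"
    by (rule subset_pair[OF H.SpecFilt_sub H.filter_A_neq_B])+
  \<comment> \<open>In each group, all five conditions say which of the two candidates are prime filters.\<close>
  have 1: "all_equivalent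
     [congruences ?S = congruences01 ?S \<union> {nabla ?S} \<and> Con ?S \<cong>\<^sub>l ordinal_sum ?K (chain_lattice 2),
      two_class_congruences ?S = {}, SpecFilt ?S = {}, SpecId ?S = {},
      (bot_meet_reducible A \<or> top_join_reducible B) \<and> (bot_meet_reducible B \<or> top_join_reducible A)]"
    (is "all_equivalent [?a, ?b, ?c, ?d, ?e]")
  proof (rule all_equivalent5I[where Q = "SpecFilt ?S = {}"])
    show "?a \<longleftrightarrow> SpecFilt ?S = {}"
      using H.Con_eq_iff[of "{}"] H.Con_iso_no_filter by (simp add: insert_commute) blast
    show "?b \<longleftrightarrow> SpecFilt ?S = {}"
      using H.two_class_eq_iff[of "{}"] by simp
    show "?d \<longleftrightarrow> SpecFilt ?S = {}"
      using H.SpecId_eq_iff[of "{}"] by (simp add: insert_commute)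
    show "?e \<longleftrightarrow> SpecFilt ?S = {}"
      unfolding Spec(1) FA FB by blast
  qed (rule refl)
  have 2: "all_equivalent
     [congruences ?S = congruences01 ?S \<union> {H.split_congruence ?FA, nabla ?S} \<and>
        Con ?S \<cong>\<^sub>l ordinal_sum ?K (chain_lattice 3),
      two_class_congruences ?S = {H.split_congruence ?FA}, SpecFilt ?S = {?FA},
      SpecId ?S = {carrier ?S - ?FA},
      bot_meet_irreducible A \<and> top_join_irreducible B \<and> (bot_meet_reducible B \<or> top_join_reducible A)]"
    (is "all_equivalent [?a, ?b, ?c, ?d, ?e]")
  proof (rule all_equivalent5I[where Q = "SpecFilt ?S = {?FA}"])
    show "?a \<longleftrightarrow> SpecFilt ?S = {?FA}"
      using H.Con_eq_iff[of "{?FA}"] H.Con_iso_one_filter[of ?FA] by (simp add: insert_commute) blast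
    show "?b \<longleftrightarrow> SpecFilt ?S = {?FA}"
      using H.two_class_eq_iff[of "{?FA}"] by simp
    show "?d \<longleftrightarrow> SpecFilt ?S = {?FA}"
      using H.SpecId_eq_iff[of "{?FA}"] by (simp add: insert_commute)
    show "?e \<longleftrightarrow> SpecFilt ?S = {?FA}"
      unfolding Spec(2) FA FB by blast
  qed (rule refl)
  have 3: "all_equivalent
     [congruences ?S = congruences01 ?S \<union> {H.split_congruence ?FB, nabla ?S} \<and>
        Con ?S \<cong>\<^sub>l ordinal_sum ?K (chain_lattice 3),
      two_class_congruences ?S = {H.split_congruence ?FB}, SpecFilt ?S = {?FB},
      SpecId ?S = {carrier ?S - ?FB},
      bot_meet_irreducible B \<and> top_join_irreducible A \<and> (bot_meet_reducible A \<or> top_join_reducible B)]"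
    (is "all_equivalent [?a, ?b, ?c, ?d, ?e]")
  proof (rule all_equivalent5I[where Q = "SpecFilt ?S = {?FB}"])
    show "?a \<longleftrightarrow> SpecFilt ?S = {?FB}"
      using H.Con_eq_iff[of "{?FB}"] H.Con_iso_one_filter[of ?FB] by (simp add: insert_commute) blast
    show "?b \<longleftrightarrow> SpecFilt ?S = {?FB}"
      using H.two_class_eq_iff[of "{?FB}"] by simp
    show "?d \<longleftrightarrow> SpecFilt ?S = {?FB}"
      using H.SpecId_eq_iff[of "{?FB}"] by (simp add: insert_commute)
    show "?e \<longleftrightarrow> SpecFilt ?S = {?FB}"
      unfolding Spec(3) FA FB by blast
  qed (rule refl)
  have 4: "all_equivalent
     [congruences ?S = congruences01 ?S \<union> {H.split_congruence ?FA, H.split_congruence ?FB, nabla ?S} \<and>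
        Con ?S \<cong>\<^sub>l ordinal_sum ?K (prod_lattice (chain_lattice 2) (chain_lattice 2)),
      card (two_class_congruences ?S) = 2, SpecFilt ?S = {?FA, ?FB},
      SpecId ?S = {carrier ?S - ?FB, carrier ?S - ?FA},
      bot_meet_irreducible A \<and> bot_meet_irreducible B \<and>
        top_join_irreducible A \<and> top_join_irreducible B]"
    (is "all_equivalent [?a, ?b, ?c, ?d, ?e]")
  proof (rule all_equivalent5I[where Q = "SpecFilt ?S = {?FA, ?FB}"])
    show "?a \<longleftrightarrow> SpecFilt ?S = {?FA, ?FB}"
      using H.Con_eq_iff[of "{?FA, ?FB}"] H.Con_iso_two_filters[OF _ H.filter_A_neq_B] by (simp add: insert_commute) blast
    show "?b \<longleftrightarrow> SpecFilt ?S = {?FA, ?FB}"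
      by (rule H.two_class_card_iff)
    show "?d \<longleftrightarrow> SpecFilt ?S = {?FA, ?FB}"
      using H.SpecId_eq_iff[of "{?FA, ?FB}"] by (simp add: insert_commute)
    show "?e \<longleftrightarrow> SpecFilt ?S = {?FA, ?FB}"
      unfolding Spec(4) FA FB by blast
  qed (rule refl)
  show ?thesis
    unfolding Let_def alpha beta
    unfolding filters cars complements[symmetric]
    using 1 2 3 4 by blast
qed

end
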